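(* Let $A\in\mathbb{R}^{n\times n}$, $B\in\mathbb{R}^{n\times 1}$, $C\in\mathbb{R}^{1\times n}$ define a stable (all eigenvalues of $A$ have negative real part) and minimal linear time-invariant system with transfer function $G(s)=C(sI_n-A)^{-1}B$. Let $\omega_1,\dots,\omega_N>0$ and $\tau_1,\dots,\tau_N>0$ be time step sizes, let $\tilde\beta_{\mathrm c},\tilde\beta_{\mathrm o}\in\mathbb{R}^s$ have strictly positive entries, and let $\Lambda_{\mathrm c},\Lambda_{\mathrm o}\in\mathbb{C}^{s\times s}$, $\beta_{\mathrm c},\beta_{\mathrm o}\in\mathbb{C}^s$ be such that $\omega_j\mu\lambda\neq 1$ and $\tau_j\nu\lambda\ne 1$ for all $j=1,\dots,N$, all eigenvalues $\mu$ of $\Lambda_{\mathrm c}$, all eigenvalues $\nu$ of $\Lambda_{\mathrm o}$ and all eigenvalues $\lambda$ of $A$. Let $\hat\Lambda_{\mathrm c}=\hat\Lambda(\Lambda_{\mathrm c},\beta_{\mathrm c},\omega_1,\dots,\omega_N)$ and $\hat\Lambda_{\mathrm o}=\hat\Lambda(\Lambda_{\mathrm o},\beta_{\mathrm o},\tau_1,\dots,\tau_N)$ be the $Ns\times Ns$ matrices defined in the context. Let $\{\hat\mu_1,\dots,\hat\mu_{q_{\mathrm c}}\}=\bigcup_{i=1}^N\sigma(\omega_i\Lambda_{\mathrm c})$ and $\{\hat\nu_1,\dots,\hat\nu_{q_{\mathrm o}}\}=\bigcup_{i=1}^N\sigma(\tau_i\Lambda_{\mathrm o})$ be the eigenvalues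 of $\hat\Lambda_{\mathrm c}$ and $\hat\Lambda_{\mathrm o}$, with multiplicities $s_1,\dots,s_{q_{\mathrm c}}$ and $t_1,\dots,t_{q_{\mathrm o}}$, respectively. Let $Z_{\mathrm c},Z_{\mathrm o}\in\mathbb{C}^{n\times Ns}$ and the reduced system matrices $\hat A,\hat B,\hat C$ be those produced by the approximate balancing procedure described in the context, and let $\hat G(s)=\hat C(sI-\hat A)^{-1}\hat B$ be the transfer function of the reduced system. If the pairs $(\hat\Lambda_{\mathrm c}^{\mathsf T},\mathbf{1}_{Ns}^{\mathsf T})$ and $(\hat\Lambda_{\mathrm o}^{\mathsf T},\mathbf{1}_{Ns}^{\mathsf T})$ are observable and $\operatorname{rank}(Z_{\mathrm o}^{\mathsf H}Z_{\mathrm c})=Ns$, then $$\hat G^{(i)}(\hat\mu_{l_{\mathrm c}}^{-1})=G^{(i)}(\hat\mu_{l_{\mathrm c}}^{-1})\quad\text{for } i=0,\dots,s_{l_{\mathrm c}}-1,$$ $$\hat G^{(i)}(\overline{\hat\nu}_{l_{\mathrm o}}^{\,-1})=G^{(i)}(\overline{\hat\nu}_{l_{\mathrm o}}^{\,-1})\quad\text{for } i=0,\dots,t_{l_{\mathrm o}}-1$$ for $l_{\mathrm c}=1,\dots,q_{\mathrm c}$ and $l_{\mathrm o}=1,\dots,q_{\mathrm o}$. For any zero eigenvalue the corresponding interpolation condition has to be read as interpolation at $\infty$ (see the context). If some of the values $\hat\mu_i$ and $\overline{\hat\nu_j}$ coincide, even higher derivatives are interpolated.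
   Context: Notation: $\sigma(\cdot)$ is the spectrum, $\mathsf T$ transpose, $\mathsf H$ conjugate transpose, the overline complex conjugation, $G^{(i)}$ the $i$-th derivative, and $\mathbf{1}_m\in\mathbb{R}^m$ the all-ones column vector. A pair $(M,c)$ with $M\in\mathbb{C}^{m\times m}$ and $c\in\mathbb{C}^{1\times m}$ is observable if the matrix with rows $c,cM,\dots,cM^{m-1}$ has rank $m$. The system $(A,B,C)$ is minimal if it is controllable and observable. Interpolation at $\infty$: this means matching of Markov parameters, the coefficients $CA^{j-1}B$ of $s^{-j}$ in the expansion of $G$ at $\infty$. Thus for a zero eigenvalue of multiplicity $k$ (of $\hat\Lambda_{\mathrm c}$ or of $\hat\Lambda_{\mathrm o}$) the condition reads $\hat C\hat A^{j-1}\hat B=CA^{j-1}B$ for $j=1,\dots,k$. The matrix $\hat\Lambda$: for $\Lambda\in\mathbb{C}^{s\times s}$, $\beta\in\mathbb{C}^s$ and step sizes $\omega_1,\dots,\omega_N>0$, the matrix $\hat\Lambda=\hat\Lambda(\Lambda,\beta,\omega_1,\dots,\omega_N)\in\mathbb{C}^{Ns\times Ns}$ is defined by specifying its transpose $\hat\Lambda^{\mathsf T}$, which is block upper triangular with $N\times N$ blocks of size $s\times s$: the $(i,i)$ block is $\omega_i\Lambda^{\mathsf T}$, the $(i,j)$ block for $i<j$ is $\omega_i[\beta,\dots,\beta]=\omega_i\beta\mathbf{1}_s^{\mathsf T}$, and the $(i,j)$ block for $i>j$ is $0$. Approximate Cholesky factor procedure: given $A$, $B$, step sizes $\omega_1,\dots,\omega_N>0$,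 $\Lambda\in\mathbb{C}^{s\times s}$, $\beta\in\mathbb{C}^s$, $\tilde\beta\in\mathbb{R}^s_{\ge0}$ with $\omega_j\mu\lambda\ne1$ for all $j$, $\mu\in\sigma(\Lambda)$, $\lambda\in\sigma(A)$, set $h_0=B$ and for $j=1,\dots,N$ let $\mathcal{H}_j\in\mathbb{C}^{n\times s}$ be the unique solution of $$\mathcal{H}_j=[h_{j-1},\dots,h_{j-1}]+\omega_jA\mathcal{H}_j\Lambda^{\mathsf T},$$ and set $h_j=h_{j-1}+\omega_jA\mathcal{H}_j\beta$. The output is $$Z=[\mathcal{H}_1\operatorname{diag}(\omega_1\tilde\beta)^{1/2},\dots,\mathcal{H}_N\operatorname{diag}(\omega_N\tilde\beta)^{1/2}]\in\mathbb{C}^{n\times Ns}.$$ Approximate balancing procedure: $Z_{\mathrm c}$ is the output $Z$ of the approximate Cholesky factor procedure applied to $A,B,\Lambda_{\mathrm c},\beta_{\mathrm c},\tilde\beta_{\mathrm c}$ and $\omega_1,\dots,\omega_N$; $Z_{\mathrm o}$ is the output $Z$ of the approximate Cholesky factor procedure applied to $A^{\mathsf T},C^{\mathsf T}$ (in place of $A,B$), $\Lambda_{\mathrm o},\beta_{\mathrm o},\tilde\beta_{\mathrm o}$ and $\tau_1,\dots,\tau_N$ (in place of $\omega_1,\dots,\omega_N$). Let $Z_{\mathrm o}^{\mathsf H}Z_{\mathrm c}=U\Sigma T^{\mathsf H}$ be a compact singular value decomposition ($\Sigma\in\mathbb{R}^{r\times r}$ diagonal with positive diagonal entries, $r=\operatorname{rank}(Z_{\mathrm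 o}^{\mathsf H}Z_{\mathrm c})$, and $U,T$ with orthonormal columns). Put $V=Z_{\mathrm c}T\Sigma^{-1/2}$, $W=Z_{\mathrm o}U\Sigma^{-1/2}$ and $$\hat A=W^{\mathsf H}AV,\qquad \hat B=W^{\mathsf H}B,\qquad \hat C=CV.$$
   Formalization: Each interpolation condition at a nonzero eigenvalue additionally assumes that the interpolation point (the inverse of μ̂, or of the conjugate of ν̂) is not an eigenvalue of Â; without this Ĝ is undefined there, and the claim can fail even for Ĝ as a rational function. *)

theory Defs
  imports
    "HOL-Complex_Analysis.Complex_Analysis"
    "Jordan_Normal_Form.Schur_Decomposition"
    "Jordan_Normal_Form.Spectral_Radius"
    "Jordan_Normal_Form.DL_Rank"
begin

text \<open>
  Matrices and vectors are those of \<^theory>\<open>Jordan_Normal_Form.Matrix\<close>, whose indices start at 0.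
  Sequences of step sizes are functions on \<^typ>\<open>nat\<close> of which only the values at
  \<open>0, \<dots>, N - 1\<close> are used, so \<open>\<omega> j\<close> is the step size of step \<open>j + 1\<close>.
\<close>

abbreviation cmat :: "real mat \<Rightarrow> complex mat" where
  "cmat \<equiv> map_mat complex_of_real"

definition ones_row :: "nat \<Rightarrow> 'a :: one mat" where
  "ones_row m = Matrix.mat 1 m (\<lambda>_. 1)"

definition observable :: "'a :: field mat \<Rightarrow> 'a mat \<Rightarrow> bool" where
  "observable M c \<longleftrightarrow> (let m = dim_row M in
     vec_space.rank m (Matrix.mat m m (\<lambda>(k, j). (c * M ^\<^sub>m k) $$ (0, j))) = m)"

text \<open>Controllability for a single input: the matrix with columns \<open>b, M b, \<dots>\<close> has full rank.\<close>

definition controllable :: "'a :: field mat \<Rightarrow> 'a mat \<Rightarrow> bool" where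
  "controllable M b \<longleftrightarrow> (let m = dim_row M in
     vec_space.rank m (Matrix.mat m m (\<lambda>(i, k). (M ^\<^sub>m k * b) $$ (i, 0))) = m)"

definition minimal_system :: "'a :: field mat \<Rightarrow> 'a mat \<Rightarrow> 'a mat \<Rightarrow> bool" where
  "minimal_system A B C \<longleftrightarrow> controllable A B \<and> observable A C"

definition stable_mat :: "real mat \<Rightarrow> bool" where
  "stable_mat A \<longleftrightarrow> (\<forall>\<alpha> \<in> spectrum (cmat A). Re \<alpha> < 0)"

text \<open>The value at an eigenvalue of \<open>A\<close> is unspecified (the inverse does not exist there).\<close>

definition transfer :: "complex mat \<Rightarrow> complex mat \<Rightarrow> complex mat \<Rightarrow> complex \<Rightarrow> complex" where
  "transfer A B C z =
     (C * the (mat_inverse (z \<cdot>\<^sub>m 1\<^sub>m (dim_row A) - A)) * B) $$ (0, 0)"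

definition hat_Lambda_transpose ::
  "nat \<Rightarrow> nat \<Rightarrow> complex mat \<Rightarrow> complex Matrix.vec \<Rightarrow> (nat \<Rightarrow> real) \<Rightarrow> complex mat" where
  "hat_Lambda_transpose N s \<Lambda> \<beta> \<omega> = Matrix.mat (N * s) (N * s) (\<lambda>(p, q).
     let i = p div s; j = q div s; a = p mod s; b = q mod s in
       if i = j then of_real (\<omega> i) * transpose_mat \<Lambda> $$ (a, b)
       else if i < j then of_real (\<omega> i) * vec_index \<beta> a
       else 0)"

definition hat_Lambda ::
  "nat \<Rightarrow> nat \<Rightarrow> complex mat \<Rightarrow> complex Matrix.vec \<Rightarrow> (nat \<Rightarrow> real) \<Rightarrow> complex mat" where
  "hat_Lambda N s \<Lambda> \<beta> \<omega> = transpose_mat (hat_Lambda_transpose N s \<Lambda> \<beta> \<omega>)"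

text \<open>
  \<open>Z\<close> is the output of the approximate Cholesky factor procedure. The matrix \<open>H j\<close> is the
  \<open>(j + 1)\<close>-st stage matrix; the equation for it has exactly one solution as soon as
  \<open>\<omega> j * \<mu> * \<alpha> \<noteq> 1\<close> for all eigenvalues \<open>\<mu>\<close> of \<open>\<Lambda>\<close> and \<open>\<alpha>\<close> of \<open>A\<close>, so that \<open>Z\<close> is then determined
  by the remaining arguments.
\<close>

definition approx_cholesky ::
  "nat \<Rightarrow> nat \<Rightarrow> nat \<Rightarrow> complex mat \<Rightarrow> complex mat \<Rightarrow> complex mat \<Rightarrow> complex Matrix.vec \<Rightarrow>
   real Matrix.vec \<Rightarrow> (nat \<Rightarrow> real) \<Rightarrow> complex mat \<Rightarrow> bool" where
  "approx_cholesky n N s A B \<Lambda> \<beta> \<beta>t \<omega> Z \<longleftrightarrow>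
     (\<exists>(h :: nat \<Rightarrow> complex Matrix.vec) (H :: nat \<Rightarrow> complex mat).
        h 0 = col B 0 \<and>
        (\<forall>j < N.
           H j \<in> carrier_mat n s \<and>
           H j = Matrix.mat n s (\<lambda>(i, k). vec_index (h j) i)
                 + of_real (\<omega> j) \<cdot>\<^sub>m (A * H j * transpose_mat \<Lambda>) \<and>
           h (Suc j) = h j + of_real (\<omega> j) \<cdot>\<^sub>v (A *\<^sub>v (H j *\<^sub>v \<beta>))) \<and>
        Z = Matrix.mat n (N * s) (\<lambda>(i, q).
              H (q div s) $$ (i, q mod s) *
              of_real (sqrt (\<omega> (q div s) * vec_index \<beta>t (q mod s)))))"

text \<open>The diagonal matrix of singular values is given by its diagonal entries \<open>\<sigma> 0, \<dots>, \<sigma> (r - 1)\<close>.\<close>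

definition compact_svd ::
  "complex mat \<Rightarrow> nat \<Rightarrow> complex mat \<Rightarrow> (nat \<Rightarrow> real) \<Rightarrow> complex mat \<Rightarrow> bool" where
  "compact_svd M r U \<sigma> T \<longleftrightarrow>
     r = vec_space.rank (dim_row M) M \<and>
     U \<in> carrier_mat (dim_row M) r \<and> T \<in> carrier_mat (dim_col M) r \<and>
     mat_adjoint U * U = 1\<^sub>m r \<and> mat_adjoint T * T = 1\<^sub>m r \<and>
     (\<forall>i < r. \<sigma> i > 0) \<and>
     M = U * mat_diag r (\<lambda>i. of_real (\<sigma> i)) * mat_adjoint T"

text \<open>
  A compact singular value decomposition is not unique; \<open>approx_balancing\<close> holds for every
  reduced system that arises from some choice of it.
\<close>

definition approx_balancing ::
  "complex mat \<Rightarrow> complex mat \<Rightarrow> complex mat \<Rightarrow> complex mat \<Rightarrow> complex mat \<Rightarrow>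
   complex mat \<Rightarrow> complex mat \<Rightarrow> complex mat \<Rightarrow> bool" where
  "approx_balancing A B C Zc Zo Ah Bh Ch \<longleftrightarrow>
     (\<exists>r U \<sigma> T. compact_svd (mat_adjoint Zo * Zc) r U \<sigma> T \<and>
        (let V = Zc * T * mat_diag r (\<lambda>i. of_real (1 / sqrt (\<sigma> i)));
             W = Zo * U * mat_diag r (\<lambda>i. of_real (1 / sqrt (\<sigma> i)))
         in Ah = mat_adjoint W * A * V \<and> Bh = mat_adjoint W * B \<and> Ch = C * V))"

text \<open>
  Interpolation to order \<open>k\<close> at \<open>inverse \<mu>\<close>, where \<open>\<mu> = 0\<close> stands for the point at infinity:
  there the first \<open>k\<close> Markov parameters are to agree.
\<close>

definition interpolates ::
  "complex mat \<Rightarrow> complex mat \<Rightarrow> complex mat \<Rightarrow> complex mat \<Rightarrow> complex mat \<Rightarrow> complex mat \<Rightarrow>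
   complex \<Rightarrow> nat \<Rightarrow> bool" where
  "interpolates Ah Bh Ch A B C \<mu> k \<longleftrightarrow>
     (if \<mu> = 0
      then \<forall>j \<in> {1..k}. Ch * Ah ^\<^sub>m (j - 1) * Bh = C * A ^\<^sub>m (j - 1) * B
      else \<forall>i < k. (deriv ^^ i) (transfer Ah Bh Ch) (inverse \<mu>)
                  = (deriv ^^ i) (transfer A B C) (inverse \<mu>))"

end

theory Submission
  imports Defs
begin

text \<open>
  In the variable \<open>\<sigma> = 1/z\<close> put \<open>R(\<sigma>) = (I - \<sigma>A)\<^sup>-\<^sup>1\<close>, so that \<open>G(z) = \<sigma> C R(\<sigma>) B\<close>, and likewise
  \<open>Rh(\<sigma>)\<close> for the reduced system. The point \<open>\<sigma> = 0\<close> is \<open>z = \<infinity>\<close>, and the Taylor coefficients of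
  \<open>C R(\<sigma>) B\<close> there are the Markov parameters. All interpolation conditions therefore say that
  \<open>E(\<sigma>) = C R(\<sigma>) B - Ch Rh(\<sigma>) Bh\<close> has a zero of a certain order at \<open>\<sigma> = \<mu>\<close>.

  The stages of the approximate Cholesky factor procedure, side by side, form the solution of one
  equation \<open>H = B 1\<^sup>T + A H L\<close> with \<open>L\<close> the transpose of the block triangular matrix of the theorem
  (\<open>approx_cholesky_stein\<close>), and \<open>Zc\<close> differs from \<open>H\<close> by an invertible column scaling. Because the
  product of the two factors has full rank, \<open>V W\<^sup>H\<close> is a projection that fixes the columns of \<open>Zc\<close>,
  hence \<open>H\<close>, and whose adjoint fixes those of \<open>Zo\<close> (\<open>balancing_projection\<close>).

  Let \<open>p\<close> be the characteristic polynomial of \<open>L\<close> and \<open>f(\<sigma>)\<close> a column of the adjugate of \<open>\<sigma>I - L\<close>,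
  so that \<open>(\<sigma>I - L) f(\<sigma>) = p(\<sigma>) g\<close> for a unit vector \<open>g\<close>. Then \<open>H f(\<sigma>)\<close> solves
  \<open>(I - \<sigma>A) y = B (1\<^sup>T f(\<sigma>))\<close> up to a term with the factor \<open>p(\<sigma>)\<close>; projecting gives the same for
  the reduced system, and subtraction shows that
  \<open>(R(\<sigma>) B - V Rh(\<sigma>) Bh) (1\<^sup>T f(\<sigma>))\<close> is a multiple of \<open>p(\<sigma>)\<close> (\<open>residual_identity\<close>).
  Observability allows to choose the column such that \<open>1\<^sup>T f(\<mu>) \<noteq> 0\<close>
  (\<open>observable_adjugate_nonzero\<close>), so the right residual \<open>R B - V Rh Bh\<close> vanishes at \<open>\<mu>\<close> at least to
  the multiplicity of \<open>\<mu>\<close> as a root of \<open>p\<close>. Working with the adjugate replaces any discussion of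
  Jordan chains of \<open>L\<close>.

  The same statement for the transposed system bounds the order of the left residual
  \<open>C R - Ch Rh W\<^sup>H\<close> at \<open>\<mu>\<close> from below by the multiplicity of the conjugate of \<open>\<mu>\<close> for the second block
  triangular matrix. Finally \<open>E\<close> is the product of the left residual, \<open>I - \<sigma>A\<close> and the right
  residual (\<open>error_eq_residual_product\<close>), so the two orders add. With a multiplicity of zero for
  points outside one of the two spectra, this one estimate contains both one-sided interpolation
  conditions and the combined one. The resolvents are holomorphic near \<open>\<mu>\<close> because the solvability
  condition of the stage equations keeps \<open>1/\<mu>\<close> out of the spectrum of \<open>A\<close>
  (\<open>inverse_hat_Lambda_eigenvalue\<close>); for the reduced matrix this is the hypothesis of each
  interpolation condition.
\<close>

section \<open>Matrix algebra and polynomial matrices\<close>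

abbreviation poly_mat :: "'a::zero mat \<Rightarrow> 'a poly mat" where
  "poly_mat \<equiv> map_mat (\<lambda>a. [:a:])"

abbreviation eval_mat :: "'a::comm_ring_1 poly mat \<Rightarrow> 'a \<Rightarrow> 'a mat" where
  "eval_mat P x \<equiv> map_mat (\<lambda>p. poly p x) P"

lemma smult_smult_times:
  "a \<cdot>\<^sub>m (b \<cdot>\<^sub>m M) = (a * b :: 'a::semigroup_mult) \<cdot>\<^sub>m M"
  by (intro eq_matI) (auto simp: mult.assoc)

lemma one_smult_mat: "(1 :: 'a::monoid_mult) \<cdot>\<^sub>m M = M"
  by (intro eq_matI) auto

lemma mult_scalar_mat:
  fixes M s :: "'a::comm_semiring_0 mat"
  assumes "M \<in> carrier_mat n 1" "s \<in> carrier_mat 1 1"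
  shows "M * s = s $$ (0, 0) \<cdot>\<^sub>m M"
  using assms by (intro eq_matI) (auto simp: scalar_prod_def mult.commute)

lemma mult_mat_entry:
  fixes M N :: "'a::semiring_0 mat"
  assumes "M \<in> carrier_mat a b" "N \<in> carrier_mat b c" "i < a" "j < c"
  shows "(M * N) $$ (i, j) = (\<Sum>k<b. M $$ (i, k) * N $$ (k, j))"
  using assms by (simp add: scalar_prod_def lessThan_atLeast0)

lemma add_diff_add_mat:
  fixes P Q W :: "complex mat"
  assumes "P \<in> carrier_mat r c" "Q \<in> carrier_mat r c" "W \<in> carrier_mat r c"
  shows "(P + Q) - (Q + W) + W = P" "(P + Q) - (P + W) = Q - W"
  using assms by (auto intro!: eq_matI)

lemma pow_mat_commute:
  fixes L :: "'a::semiring_1 mat"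
  assumes "L \<in> carrier_mat m m"
  shows "L * L ^\<^sub>m k = L ^\<^sub>m k * L"
proof (induction k)
  case (Suc k)
  have "L * L ^\<^sub>m Suc k = (L * L ^\<^sub>m k) * L"
    using assms by (simp add: assoc_mult_mat[of _ m m _ m _ m])
  then show ?case using Suc by simp
qed (use assms in auto)

lemma mat_inverse_eq:
  fixes M X :: "'a::field mat"
  assumes M: "M \<in> carrier_mat n n" and X: "X \<in> carrier_mat n n" and MX: "M * X = 1\<^sub>m n"
  shows "mat_inverse M = Some X"
proof (cases "mat_inverse M")
  case None
  have "Determinant.det M \<noteq> 0"
    using det_mult[OF M X] MX by auto
  then have "M \<in> Units (ring_mat TYPE('a) n undefined)" by (rule det_non_zero_imp_unit[OF M])
  with mat_inverse(1)[OF M None, of undefined] show ?thesis by blast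
next
  case (Some Y)
  from mat_inverse(2)[OF M Some] have Y: "Y * M = 1\<^sub>m n" "Y \<in> carrier_mat n n" by auto
  have "Y = Y * (M * X)" using Y by (simp add: MX)
  also have "\<dots> = X" unfolding assoc_mult_mat[OF Y(2) M X, symmetric] Y(1) using X by simp
  finally show ?thesis using Some by simp
qed

lemma eval_mat_mult:
  assumes "P \<in> carrier_mat a b" "Q \<in> carrier_mat b c"
  shows "eval_mat (P * Q) x = eval_mat P x * eval_mat Q x"
  using assms by (intro eq_matI) (auto simp: scalar_prod_def poly_sum)

section \<open>Observability and the adjugate\<close>

text \<open>
  Right evaluation at \<open>L\<close>: a row of polynomials that is divisible by \<open>xI - L\<close> on the right vanishes
  when the powers of \<open>x\<close> are replaced by those of \<open>L\<close>, written to the right of the coefficients.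
  Comparing coefficients turns the sum into a telescoping one.
\<close>

lemma right_remainder_zero:
  fixes L e :: "'a::field mat"
  assumes L: "L \<in> carrier_mat m m" and e: "e \<in> carrier_mat 1 m" and b: "b \<in> carrier_mat 1 m"
    and eq: "b * char_poly_matrix L = q \<cdot>\<^sub>m poly_mat e"
    and j: "j < m"
  shows "(\<Sum>k\<le>degree q. coeff q k * (e * L ^\<^sub>m k) $$ (0, j)) = 0"
proof -
  \<comment> \<open>Shifted by one, so that the coefficient equation has the same form for \<open>k = 0\<close>.\<close>
  define r where "r k = Matrix.mat 1 m (\<lambda>(_, j). coeff (pCons 0 (b $$ (0, j))) k)" for k
  have r: "r k \<in> carrier_mat 1 m" for k by (simp add: r_def)
  have step: "coeff q k \<cdot>\<^sub>m e = r k - r (Suc k) * L" for k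
  proof (rule eq_matI)
    fix i j assume "i < dim_row (r k - r (Suc k) * L)" "j < dim_col (r k - r (Suc k) * L)"
    then have i: "i = 0" and j: "j < m" using L by (auto simp: r_def)
    have "q * [:e $$ (0, j):] = (b * char_poly_matrix L) $$ (0, j)"
      using e j by (simp add: eq)
    also have "\<dots> = (\<Sum>i<m. b $$ (0, i) * char_poly_matrix L $$ (i, j))"
      using b L j by (simp add: scalar_prod_def char_poly_matrix_def lessThan_atLeast0)
    also have "\<dots> = (\<Sum>i<m. (if i = j then pCons 0 (b $$ (0, i)) else 0)
                        - Polynomial.smult (L $$ (i, j)) (b $$ (0, i)))"
      using L j by (intro sum.cong) (auto simp: char_poly_matrix_def algebra_simps)
    also have "\<dots> = pCons 0 (b $$ (0, j)) - (\<Sum>i<m. Polynomial.smult (L $$ (i, j)) (b $$ (0, i)))"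
      using j by (simp add: sum_subtractf)
    finally have "coeff (q * [:e $$ (0, j):]) k
       = coeff (pCons 0 (b $$ (0, j))) k - (\<Sum>i<m. L $$ (i, j) * coeff (b $$ (0, i)) k)"
      by (simp add: coeff_sum)
    then show "(coeff q k \<cdot>\<^sub>m e) $$ (i, j) = (r k - r (Suc k) * L) $$ (i, j)"
      using e i j L by (simp add: r_def scalar_prod_def lessThan_atLeast0 mult.commute)
  qed (use e L in \<open>auto simp: r_def\<close>)
  have tele: "(\<Sum>k\<le>K. coeff q k * (e * L ^\<^sub>m k) $$ (0, j)) = - (r (Suc K) * L ^\<^sub>m Suc K) $$ (0, j)" for K
  proof (induction K)
    case 0
    have "coeff q 0 * e $$ (0, j) = (coeff q 0 \<cdot>\<^sub>m e) $$ (0, j)" using e j by simp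
    also have "\<dots> = - (r 1 * L) $$ (0, j)"
      unfolding step using L j r[of 1] r[of 0] by (simp add: r_def)
    finally show ?case using e L j by simp
  next
    case (Suc K)
    define M where "M = L ^\<^sub>m Suc K"
    have M: "M \<in> carrier_mat m m" using L unfolding M_def by (rule pow_carrier_mat)
    have LM: "L * M = L ^\<^sub>m Suc (Suc K)" using pow_mat_commute[OF L, of "Suc K"] by (simp add: M_def)
    have "coeff q (Suc K) * (e * M) $$ (0, j) = ((coeff q (Suc K) \<cdot>\<^sub>m e) * M) $$ (0, j)"
      using e M j by (simp add: mult_smult_assoc_mat[OF e M])
    also have "\<dots> = (r (Suc K) * M - r (Suc (Suc K)) * (L * M)) $$ (0, j)"
      unfolding step using minus_mult_distrib_mat[OF r[of "Suc K"] _ M, of "r (Suc (Suc K)) * L"]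
        assoc_mult_mat[OF r[of "Suc (Suc K)"] L M] r[of "Suc (Suc K)"] L by simp
    also have "\<dots> = (r (Suc K) * M) $$ (0, j) - (r (Suc (Suc K)) * (L * M)) $$ (0, j)"
      using r L M j by (simp add: r_def)
    finally show ?case using Suc unfolding LM by (simp add: M_def[symmetric] del: pow_mat.simps)
  qed
  \<comment> \<open>Beyond all degrees, so that the end term of the telescoping sum is zero.\<close>
  define K where "K = degree q + (\<Sum>i<m. Suc (degree (b $$ (0, i))))"
  have "r (Suc K) = 0\<^sub>m 1 m"
  proof (rule eq_matI)
    fix i j assume "i < dim_row (0\<^sub>m 1 m :: 'a mat)" "j < dim_col (0\<^sub>m 1 m :: 'a mat)"
    then have j: "i = 0" "j < m" by auto
    have "degree (b $$ (0, j)) < (\<Sum>i<m. Suc (degree (b $$ (0, i))))"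
      using member_le_sum[of j "{..<m}" "\<lambda>i. Suc (degree (b $$ (0, i)))"] j by simp
    then show "r (Suc K) $$ (i, j) = 0\<^sub>m 1 m $$ (i, j)"
      using j by (simp add: r_def K_def coeff_eq_0)
  qed (auto simp: r_def)
  then have "(\<Sum>k\<le>K. coeff q k * (e * L ^\<^sub>m k) $$ (0, j)) = 0"
    unfolding tele using L j by (simp del: pow_mat.simps add: left_mult_zero_mat[of _ m m] pow_carrier_mat)
  moreover have "(\<Sum>k\<le>K. coeff q k * (e * L ^\<^sub>m k) $$ (0, j))
      = (\<Sum>k\<le>degree q. coeff q k * (e * L ^\<^sub>m k) $$ (0, j))"
    by (rule sum.mono_neutral_right) (auto simp: K_def coeff_eq_0)
  ultimately show ?thesis by simp
qed

lemma observable_iff_det: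
  fixes L :: "'a::field mat"
  assumes "L \<in> carrier_mat m m"
  shows "observable L e \<longleftrightarrow> Determinant.det (Matrix.mat m m (\<lambda>(k, j). (e * L ^\<^sub>m k) $$ (0, j))) \<noteq> 0"
  using assms by (simp add: observable_def Let_def vec_space.det_rank_iff[of _ m])

text \<open>
  If \<open>\<mu>\<close> were a root of every entry of the row \<open>e adj(xI - L)\<close>, then a factor \<open>x - \<mu>\<close> could be
  cancelled in \<open>e adj(xI - L) (xI - L) = p e\<close>. The quotient of \<open>p\<close> has degree \<open>m - 1\<close>, and
  evaluating at \<open>L\<close> gives a linear relation between \<open>e, eL, \<dots>, eL\<^sup>m\<^sup>-\<^sup>1\<close>, against observability.
\<close>

lemma observable_adjugate_nonzero:
  fixes L e :: "'a::field mat"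
  assumes L: "L \<in> carrier_mat m m" and e: "e \<in> carrier_mat 1 m" and m: "m > 0"
    and obs: "observable L e"
  shows "\<exists>j<m. poly ((poly_mat e * adj_mat (char_poly_matrix L)) $$ (0, j)) \<mu> \<noteq> 0"
proof (rule ccontr)
  define a where "a = poly_mat e * adj_mat (char_poly_matrix L)"
  assume "\<not> ?thesis"
  then have root: "poly (a $$ (0, j)) \<mu> = 0" if "j < m" for j using that by (auto simp: a_def)
  have adj: "adj_mat (char_poly_matrix L) \<in> carrier_mat m m"
     "adj_mat (char_poly_matrix L) * char_poly_matrix L = char_poly L \<cdot>\<^sub>m 1\<^sub>m m"
    using adj_mat[OF char_poly_matrix_closed[OF L]] by (auto simp: char_poly_def)
  have a: "a \<in> carrier_mat 1 m" using e adj by (simp add: a_def)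
  have E: "poly_mat e \<in> carrier_mat 1 m" using e by simp
  have acp: "a * char_poly_matrix L = char_poly L \<cdot>\<^sub>m poly_mat e"
    unfolding a_def assoc_mult_mat[OF E adj(1) char_poly_matrix_closed[OF L]] adj(2)
    using E by (simp add: mult_smult_distrib[OF E one_carrier_mat])
  define O' where "O' = Matrix.mat m m (\<lambda>(k, j). (e * L ^\<^sub>m k) $$ (0, j))"
  have "Determinant.det O' \<noteq> 0"
    using obs observable_iff_det[OF L] by (simp add: O'_def)
  then have det: "Determinant.det (transpose_mat O') \<noteq> 0"
    by (subst det_transpose[of _ m]) (auto simp: O'_def)
  have indep: "w = 0\<^sub>v m" if "w \<in> carrier_vec m" "\<And>j. j < m \<Longrightarrow> (\<Sum>k<m. vec_index w k * (e * L ^\<^sub>m k) $$ (0, j)) = 0" for w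
  proof -
    have "transpose_mat O' *\<^sub>v w = 0\<^sub>v m"
      using that by (intro eq_vecI) (auto simp: O'_def scalar_prod_def lessThan_atLeast0 mult.commute)
    then show ?thesis
      using det_0_iff_vec_prod_zero_field[of "transpose_mat O'" m] det that(1) by (auto simp: O'_def)
  qed
  have "\<exists>j0<m. e $$ (0, j0) \<noteq> 0"
  proof (rule ccontr)
    assume "\<not> ?thesis"
    then have "e = 0\<^sub>m 1 m" using e by (intro eq_matI) auto
    have "unit_vec m 0 = (0\<^sub>v m :: 'a Matrix.vec)"
      by (rule indep) (use \<open>e = 0\<^sub>m 1 m\<close> L in \<open>auto simp: left_mult_zero_mat[of _ m m] pow_carrier_mat\<close>)
    then have "vec_index (unit_vec m 0) 0 = vec_index (0\<^sub>v m :: 'a Matrix.vec) 0" by simp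
    then show False using m by simp
  qed
  then obtain j0 where j0: "j0 < m" "e $$ (0, j0) \<noteq> 0" by blast
  have "char_poly L * [:e $$ (0, j0):] = (a * char_poly_matrix L) $$ (0, j0)"
    unfolding acp using e j0 by simp
  also have "\<dots> = (\<Sum>i<m. a $$ (0, i) * char_poly_matrix L $$ (i, j0))"
    using a L j0 by (simp add: scalar_prod_def char_poly_matrix_def lessThan_atLeast0)
  finally have ce: "char_poly L * [:e $$ (0, j0):] = (\<Sum>i<m. a $$ (0, i) * char_poly_matrix L $$ (i, j0))" .
  have "poly (char_poly L * [:e $$ (0, j0):]) \<mu> = 0"
    unfolding ce poly_sum poly_mult by (simp add: root)
  then have "poly (char_poly L) \<mu> = 0" using j0 by simp
  then obtain q where q: "char_poly L = [:-\<mu>, 1:] * q" unfolding poly_eq_0_iff_dvd by (elim dvdE)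
  define b where "b = Matrix.mat 1 m (\<lambda>(_, j). a $$ (0, j) div [:-\<mu>, 1:])"
  have b: "b \<in> carrier_mat 1 m" by (simp add: b_def)
  have ab: "a = [:-\<mu>, 1:] \<cdot>\<^sub>m b"
  proof (rule eq_matI)
    fix i j assume "i < dim_row ([:-\<mu>, 1:] \<cdot>\<^sub>m b)" "j < dim_col ([:-\<mu>, 1:] \<cdot>\<^sub>m b)"
    then have j: "i = 0" "j < m" by (auto simp: b_def)
    have "[:-\<mu>, 1:] * (a $$ (0, j) div [:-\<mu>, 1:]) = a $$ (0, j)"
      using root[OF j(2)] by (intro dvd_mult_div_cancel) (simp add: poly_eq_0_iff_dvd)
    then show "a $$ (i, j) = ([:-\<mu>, 1:] \<cdot>\<^sub>m b) $$ (i, j)"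
      using j by (simp add: b_def del: mult_pCons_left)
  qed (use a in \<open>auto simp: b_def\<close>)
  have scaled: "[:-\<mu>, 1:] \<cdot>\<^sub>m (b * char_poly_matrix L) = [:-\<mu>, 1:] \<cdot>\<^sub>m (q \<cdot>\<^sub>m poly_mat e)"
    using acp unfolding ab mult_smult_assoc_mat[OF b char_poly_matrix_closed[OF L]] q
    by (simp add: smult_smult_times)
  have bq: "b * char_poly_matrix L = q \<cdot>\<^sub>m poly_mat e"
  proof (intro eq_matI)
    fix i j assume "i < dim_row (q \<cdot>\<^sub>m poly_mat e)" "j < dim_col (q \<cdot>\<^sub>m poly_mat e)"
    then have ij: "i < 1" "j < m" using e by auto
    have "([:-\<mu>, 1:] \<cdot>\<^sub>m (b * char_poly_matrix L)) $$ (i, j) = ([:-\<mu>, 1:] \<cdot>\<^sub>m (q \<cdot>\<^sub>m poly_mat e)) $$ (i, j)"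
      unfolding scaled ..
    then have "[:-\<mu>, 1:] * (b * char_poly_matrix L) $$ (i, j) = [:-\<mu>, 1:] * (q \<cdot>\<^sub>m poly_mat e) $$ (i, j)"
      using ij b e char_poly_matrix_closed[OF L]
      by (subst (asm) (1 2) index_smult_mat) auto
    then show "(b * char_poly_matrix L) $$ (i, j) = (q \<cdot>\<^sub>m poly_mat e) $$ (i, j)"
      by (subst (asm) mult_cancel_left) auto
  qed (use b e char_poly_matrix_closed[OF L] in auto)
  have deg: "degree (char_poly L) = m" "lead_coeff (char_poly L) = 1"
    using degree_monic_char_poly[OF L] by auto
  have q0: "q \<noteq> 0" using q deg by auto
  have dq: "Suc (degree q) = m"
    using deg(1) q0 unfolding q by (subst (asm) degree_mult_eq) auto
  have "Matrix.vec m (coeff q) = 0\<^sub>v m"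
  proof (rule indep)
    fix j assume j: "j < m"
    show "(\<Sum>k<m. vec_index (Matrix.vec m (coeff q)) k * (e * L ^\<^sub>m k) $$ (0, j)) = 0"
      using right_remainder_zero[OF L e b bq j] unfolding dq[symmetric] lessThan_Suc_atMost
      by (simp add: less_Suc_eq_le)
  qed auto
  then have "vec_index (Matrix.vec m (coeff q)) (degree q) = vec_index (0\<^sub>v m) (degree q)" by simp
  then show False using dq q0 by simp
qed

section \<open>The pencil of a matrix and its inverse\<close>

definition pencil :: "complex mat \<Rightarrow> complex \<Rightarrow> complex mat" where
  "pencil A \<sigma> = 1\<^sub>m (dim_row A) - \<sigma> \<cdot>\<^sub>m A"

definition pencil_poly :: "complex mat \<Rightarrow> complex poly mat" where
  "pencil_poly A = Matrix.mat (dim_row A) (dim_row A) (\<lambda>(i, j). [:if i = j then 1 else 0, - A $$ (i, j):])"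

text \<open>
  Built from the adjugate of the polynomial matrix \<open>I - xA\<close>, so that all entries are visibly rational
  functions of \<open>\<sigma>\<close>; this is where their holomorphy comes from.
\<close>

definition pencil_inv :: "complex mat \<Rightarrow> complex \<Rightarrow> complex mat" where
  "pencil_inv A \<sigma> = inverse (Determinant.det (pencil A \<sigma>)) \<cdot>\<^sub>m eval_mat (adj_mat (pencil_poly A)) \<sigma>"

lemma pencil_carrier: "A \<in> carrier_mat n n \<Longrightarrow> pencil A \<sigma> \<in> carrier_mat n n"
  by (auto simp: pencil_def intro!: minus_carrier_mat)

lemma pencil_poly_carrier: "A \<in> carrier_mat n n \<Longrightarrow> pencil_poly A \<in> carrier_mat n n"
  by (simp add: pencil_poly_def)

lemma eval_pencil_poly: "A \<in> carrier_mat n n \<Longrightarrow> eval_mat (pencil_poly A) \<sigma> = pencil A \<sigma>"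
  by (intro eq_matI) (auto simp: pencil_poly_def pencil_def)

lemma det_pencil:
  assumes "A \<in> carrier_mat n n"
  shows "Determinant.det (pencil A \<sigma>) = poly (Determinant.det (pencil_poly A)) \<sigma>"
  unfolding eval_pencil_poly[OF assms, symmetric]
  by (rule poly_det_cong[symmetric, of _ n]) (use pencil_poly_carrier[OF assms] in auto)

lemma pencil_inv_carrier: "A \<in> carrier_mat n n \<Longrightarrow> pencil_inv A \<sigma> \<in> carrier_mat n n"
  using adj_mat(1)[OF pencil_poly_carrier] by (simp add: pencil_inv_def)

lemma pencil_inv:
  assumes A: "A \<in> carrier_mat n n" and det: "Determinant.det (pencil A \<sigma>) \<noteq> 0"
  shows "pencil A \<sigma> * pencil_inv A \<sigma> = 1\<^sub>m n" "pencil_inv A \<sigma> * pencil A \<sigma> = 1\<^sub>m n"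
proof -
  note P = pencil_poly_carrier[OF A]
  note adj = adj_mat[OF P]
  have "pencil A \<sigma> * eval_mat (adj_mat (pencil_poly A)) \<sigma>
      = eval_mat (Determinant.det (pencil_poly A) \<cdot>\<^sub>m 1\<^sub>m n) \<sigma>"
    unfolding adj(2)[symmetric] eval_mat_mult[OF P adj(1)] eval_pencil_poly[OF A] ..
  also have "\<dots> = Determinant.det (pencil A \<sigma>) \<cdot>\<^sub>m 1\<^sub>m n"
    by (intro eq_matI) (auto simp: det_pencil[OF A])
  finally have "pencil A \<sigma> * pencil_inv A \<sigma>
      = inverse (Determinant.det (pencil A \<sigma>)) \<cdot>\<^sub>m (Determinant.det (pencil A \<sigma>) \<cdot>\<^sub>m 1\<^sub>m n)"
    unfolding pencil_inv_def using adj(1)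
    by (subst mult_smult_distrib[OF pencil_carrier[OF A]]) auto
  then show "pencil A \<sigma> * pencil_inv A \<sigma> = 1\<^sub>m n"
    using det by (intro eq_matI) (auto simp: smult_smult_times)
  then show "pencil_inv A \<sigma> * pencil A \<sigma> = 1\<^sub>m n"
    by (rule mat_mult_left_right_inverse[OF pencil_carrier[OF A] pencil_inv_carrier[OF A]])
qed

lemma pencil_inv_unique:
  assumes A: "A \<in> carrier_mat n n" and X: "X \<in> carrier_mat n n" and "pencil A \<sigma> * X = 1\<^sub>m n"
  shows "Determinant.det (pencil A \<sigma>) \<noteq> 0" "pencil_inv A \<sigma> = X"
proof -
  have "Determinant.det (pencil A \<sigma>) * Determinant.det X = 1"
    unfolding det_mult[OF pencil_carrier[OF A] X, symmetric] assms(3) by simp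
  then show d: "Determinant.det (pencil A \<sigma>) \<noteq> 0" by auto
  have "pencil_inv A \<sigma> = pencil_inv A \<sigma> * (pencil A \<sigma> * X)"
    unfolding assms(3) using pencil_inv_carrier[OF A, of \<sigma>] by simp
  also have "\<dots> = X"
    using assoc_mult_mat[OF pencil_inv_carrier[OF A] pencil_carrier[OF A] X, symmetric]
      pencil_inv(2)[OF A d] X by simp
  finally show "pencil_inv A \<sigma> = X" .
qed

lemma pencil_transpose:
  assumes "A \<in> carrier_mat n n"
  shows "pencil (transpose_mat A) \<sigma> = transpose_mat (pencil A \<sigma>)"
  using assms by (intro eq_matI) (auto simp: pencil_def)

lemma det_pencil_transpose:
  assumes "A \<in> carrier_mat n n"
  shows "Determinant.det (pencil (transpose_mat A) \<sigma>) = Determinant.det (pencil A \<sigma>)"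
  unfolding pencil_transpose[OF assms] by (rule det_transpose[OF pencil_carrier[OF assms]])

lemma pencil_inv_transpose:
  assumes A: "A \<in> carrier_mat n n" and det: "Determinant.det (pencil A \<sigma>) \<noteq> 0"
  shows "pencil_inv (transpose_mat A) \<sigma> = transpose_mat (pencil_inv A \<sigma>)"
proof (rule pencil_inv_unique(2))
  show "pencil (transpose_mat A) \<sigma> * transpose_mat (pencil_inv A \<sigma>) = 1\<^sub>m n"
    unfolding pencil_transpose[OF A]
    using transpose_mult[OF pencil_inv_carrier[OF A] pencil_carrier[OF A], symmetric]
      pencil_inv(2)[OF A det] by simp
qed (use A pencil_inv_carrier[OF A] in auto)

lemma det_pencil_nonzero:
  assumes A: "A \<in> carrier_mat n n" and "\<mu> \<noteq> 0 \<Longrightarrow> inverse \<mu> \<notin> spectrum A"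
  shows "Determinant.det (pencil A \<mu>) \<noteq> 0"
proof (cases "\<mu> = 0")
  case True
  then have "pencil A \<mu> = 1\<^sub>m n" using A by (intro eq_matI) (auto simp: pencil_def)
  then show ?thesis by simp
next
  case False
  have "pencil A \<mu> = \<mu> \<cdot>\<^sub>m (- char_matrix A (inverse \<mu>))"
    using A False by (intro eq_matI) (auto simp: pencil_def char_matrix_def algebra_simps)
  moreover have "Determinant.det (- char_matrix A (inverse \<mu>)) \<noteq> 0"
    unfolding char_poly_matrix[OF A, symmetric] using assms(2)[OF False] spectrum_root_char_poly[OF A] by auto
  ultimately show ?thesis using False by simp
qed

section \<open>Holomorphic families of matrices\<close>

text \<open>
  The dimensions are recorded because entries outside them are unspecified.
\<close>

definition hol_mat :: "nat \<Rightarrow> nat \<Rightarrow> (complex \<Rightarrow> complex mat) \<Rightarrow> complex set \<Rightarrow> bool" where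
  "hol_mat r c M S \<longleftrightarrow> (\<forall>\<sigma>\<in>S. M \<sigma> \<in> carrier_mat r c) \<and>
     (\<forall>i<r. \<forall>j<c. (\<lambda>\<sigma>. M \<sigma> $$ (i, j)) holomorphic_on S)"

lemma hol_mat_carrier: "hol_mat r c M S \<Longrightarrow> \<sigma> \<in> S \<Longrightarrow> M \<sigma> \<in> carrier_mat r c"
  by (simp add: hol_mat_def)

lemma hol_mat_entry: "hol_mat r c M S \<Longrightarrow> i < r \<Longrightarrow> j < c \<Longrightarrow> (\<lambda>\<sigma>. M \<sigma> $$ (i, j)) holomorphic_on S"
  by (simp add: hol_mat_def)

lemma hol_mat_subset: "hol_mat r c M S \<Longrightarrow> T \<subseteq> S \<Longrightarrow> hol_mat r c M T"
  unfolding hol_mat_def using holomorphic_on_subset by blast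

lemma hol_mat_const: "M \<in> carrier_mat r c \<Longrightarrow> hol_mat r c (\<lambda>_. M) S"
  by (auto simp: hol_mat_def)

lemma hol_mat_mult:
  assumes M: "hol_mat a b M S" and N: "hol_mat b c N S"
  shows "hol_mat a c (\<lambda>\<sigma>. M \<sigma> * N \<sigma>) S"
  unfolding hol_mat_def
proof (intro conjI allI impI ballI)
  fix i j assume ij: "i < a" "j < c"
  have "(\<lambda>\<sigma>. \<Sum>k<b. M \<sigma> $$ (i, k) * N \<sigma> $$ (k, j)) holomorphic_on S"
    using ij by (intro holomorphic_intros hol_mat_entry[OF M] hol_mat_entry[OF N]) auto
  then show "(\<lambda>\<sigma>. (M \<sigma> * N \<sigma>) $$ (i, j)) holomorphic_on S"
  proof (rule holomorphic_transform)
    fix \<sigma> assume s: "\<sigma> \<in> S"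
    show "(\<Sum>k<b. M \<sigma> $$ (i, k) * N \<sigma> $$ (k, j)) = (M \<sigma> * N \<sigma>) $$ (i, j)"
      using hol_mat_carrier[OF M s] hol_mat_carrier[OF N s] ij
      by (auto simp: scalar_prod_def lessThan_atLeast0)
  qed
next
  fix \<sigma> assume "\<sigma> \<in> S"
  then show "M \<sigma> * N \<sigma> \<in> carrier_mat a c"
    using mult_carrier_mat[OF hol_mat_carrier[OF M] hol_mat_carrier[OF N]] by blast
qed

lemma hol_mat_diff:
  assumes M: "hol_mat a b M S" and N: "hol_mat a b N S"
  shows "hol_mat a b (\<lambda>\<sigma>. M \<sigma> - N \<sigma>) S"
  unfolding hol_mat_def
proof (intro conjI allI impI ballI)
  fix i j assume ij: "i < a" "j < b"
  have "(\<lambda>\<sigma>. M \<sigma> $$ (i, j) - N \<sigma> $$ (i, j)) holomorphic_on S"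
    using ij by (intro holomorphic_intros hol_mat_entry[OF M] hol_mat_entry[OF N]) auto
  then show "(\<lambda>\<sigma>. (M \<sigma> - N \<sigma>) $$ (i, j)) holomorphic_on S"
  proof (rule holomorphic_transform)
    fix \<sigma> assume s: "\<sigma> \<in> S"
    show "M \<sigma> $$ (i, j) - N \<sigma> $$ (i, j) = (M \<sigma> - N \<sigma>) $$ (i, j)"
      using hol_mat_carrier[OF M s] hol_mat_carrier[OF N s] ij by auto
  qed
qed (use hol_mat_carrier[OF M] hol_mat_carrier[OF N] in \<open>auto intro!: minus_carrier_mat\<close>)

lemma hol_mat_smult:
  assumes M: "hol_mat a b M S" and f: "f holomorphic_on S"
  shows "hol_mat a b (\<lambda>\<sigma>. f \<sigma> \<cdot>\<^sub>m M \<sigma>) S"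
  unfolding hol_mat_def
proof (intro conjI allI impI ballI)
  fix i j assume ij: "i < a" "j < b"
  have "(\<lambda>\<sigma>. f \<sigma> * M \<sigma> $$ (i, j)) holomorphic_on S"
    using ij by (intro holomorphic_intros hol_mat_entry[OF M] f) auto
  then show "(\<lambda>\<sigma>. (f \<sigma> \<cdot>\<^sub>m M \<sigma>) $$ (i, j)) holomorphic_on S"
  proof (rule holomorphic_transform)
    fix \<sigma> assume s: "\<sigma> \<in> S"
    show "f \<sigma> * M \<sigma> $$ (i, j) = (f \<sigma> \<cdot>\<^sub>m M \<sigma>) $$ (i, j)"
      using hol_mat_carrier[OF M s] ij by auto
  qed
qed (use hol_mat_carrier[OF M] in auto)

lemma hol_mat_transpose:
  assumes M: "hol_mat a b M S"
  shows "hol_mat b a (\<lambda>\<sigma>. transpose_mat (M \<sigma>)) S"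
  unfolding hol_mat_def
proof (intro conjI allI impI ballI)
  fix i j assume ij: "i < b" "j < a"
  show "(\<lambda>\<sigma>. transpose_mat (M \<sigma>) $$ (i, j)) holomorphic_on S"
  proof (rule holomorphic_transform[OF hol_mat_entry[OF M ij(2,1)]])
    fix \<sigma> assume "\<sigma> \<in> S"
    then have "M \<sigma> \<in> carrier_mat a b" by (rule hol_mat_carrier[OF M])
    then show "M \<sigma> $$ (j, i) = transpose_mat (M \<sigma>) $$ (i, j)" using ij by auto
  qed
qed (use hol_mat_carrier[OF M] in auto)

lemma hol_mat_eval: "P \<in> carrier_mat a b \<Longrightarrow> hol_mat a b (eval_mat P) S"
  by (auto simp: hol_mat_def intro!: poly_holomorphic_on holomorphic_on_ident)

lemma hol_mat_pencil: "A \<in> carrier_mat n n \<Longrightarrow> hol_mat n n (pencil A) S"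
  unfolding pencil_def
  by (intro hol_mat_diff hol_mat_smult hol_mat_const holomorphic_intros) auto

lemma hol_mat_pencil_inv:
  assumes "A \<in> carrier_mat n n" "\<And>\<sigma>. \<sigma> \<in> S \<Longrightarrow> Determinant.det (pencil A \<sigma>) \<noteq> 0"
  shows "hol_mat n n (pencil_inv A) S"
  unfolding pencil_inv_def
  using assms(2) adj_mat(1)[OF pencil_poly_carrier[OF assms(1)]]
  by (intro hol_mat_smult hol_mat_eval) (auto intro!: holomorphic_intros simp: det_pencil[OF assms(1)])

lemma open_det_pencil:
  assumes "A \<in> carrier_mat n n"
  shows "open {\<sigma>. Determinant.det (pencil A \<sigma>) \<noteq> 0}"
  unfolding det_pencil[OF assms]
  by (intro open_Collect_neq continuous_intros)

section \<open>Order of the one-sided residuals\<close>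

text \<open>
  With \<open>y = H f\<close> the hypotheses give \<open>B (e f) = (I - \<sigma>A) y + p A H g\<close>. Since \<open>V Wt\<close> fixes \<open>y\<close>, the
  reduced pencil maps \<open>Wt y\<close> to \<open>Wt (I - \<sigma>A) y\<close>. Applying both resolvents recovers \<open>y\<close> twice, and
  only the terms with the factor \<open>p\<close> survive in the difference.
\<close>

lemma residual_identity:
  fixes A :: "complex mat"
  assumes A: "A \<in> carrier_mat n n" and B: "B \<in> carrier_mat n 1" and e: "e \<in> carrier_mat 1 m"
    and L: "L \<in> carrier_mat m m" and H: "H \<in> carrier_mat n m"
    and V: "V \<in> carrier_mat n r" and Wt: "Wt \<in> carrier_mat r n"
    and R: "R \<in> carrier_mat n n" and Rh: "Rh \<in> carrier_mat r r"
    and f: "f \<in> carrier_mat m 1" and g: "g \<in> carrier_mat m 1"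
    and HB: "H = B * e + A * H * L" and VWH: "V * (Wt * H) = H"
    and RA: "R * pencil A \<sigma> = 1\<^sub>m n" and RhA: "Rh * pencil (Wt * A * V) \<sigma> = 1\<^sub>m r"
    and fg: "\<sigma> \<cdot>\<^sub>m f = L * f + p \<cdot>\<^sub>m g"
  shows "(R * B - V * Rh * (Wt * B)) * (e * f) = p \<cdot>\<^sub>m ((R - V * Rh * Wt) * (A * (H * g)))"
proof -
  define y where "y = H * f"
  define w where "w = A * (H * g)"
  define S where "S = pencil A \<sigma>"
  have y: "y \<in> carrier_mat n 1" and w: "w \<in> carrier_mat n 1" and S: "S \<in> carrier_mat n n"
    using A H f g by (auto simp: y_def w_def S_def intro: pencil_carrier)
  have "y = B * (e * f) + A * (H * (L * f))"
    unfolding y_def using arg_cong[OF HB, of "\<lambda>M. M * f"] A B e L H f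
    by (simp add: add_mult_distrib_mat[of _ n m] assoc_mult_mat[of _ n 1 _ m _ 1]
        assoc_mult_mat[of _ n n _ m _ 1] assoc_mult_mat[of _ n m _ m _ 1]
        assoc_mult_mat[of _ n n _ m _ m])
  moreover have "\<sigma> \<cdot>\<^sub>m (A * y) = A * (H * (L * f)) + p \<cdot>\<^sub>m w"
  proof -
    have "\<sigma> \<cdot>\<^sub>m (A * y) = A * (H * (\<sigma> \<cdot>\<^sub>m f))"
      unfolding y_def using A H f by (simp add: mult_smult_distrib[of _ n m] mult_smult_distrib[of _ n n _ 1])
    also have "\<dots> = A * (H * (L * f)) + p \<cdot>\<^sub>m w"
      unfolding fg w_def using A H L f g
      by (simp add: mult_add_distrib_mat[of _ n m _ 1] mult_add_distrib_mat[of _ n n _ 1]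
          mult_smult_distrib[of _ n m] mult_smult_distrib[of _ n n _ 1])
    finally show ?thesis .
  qed
  moreover have "S * y = y - \<sigma> \<cdot>\<^sub>m (A * y)"
    unfolding S_def pencil_def using A y
    by (simp add: minus_mult_distrib_mat[of _ n n _ _ 1] mult_smult_assoc_mat[of _ n n _ 1])
  ultimately have Bef: "B * (e * f) = S * y + p \<cdot>\<^sub>m w"
    using add_diff_add_mat(1)[of "B * (e * f)" n 1 "A * (H * (L * f))" "p \<cdot>\<^sub>m w"] A B e f H L w
    by (simp add: mult_carrier_mat[of _ n 1 _ 1] mult_carrier_mat[of _ n n _ 1] mult_carrier_mat[of _ n m _ 1]
        mult_carrier_mat[of _ m m _ 1] mult_carrier_mat[of _ 1 m _ 1])
  have Sh: "Wt * (S * y) = pencil (Wt * A * V) \<sigma> * (Wt * y)"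
  proof -
    have Vy: "V * (Wt * y) = y"
      using arg_cong[OF VWH, of "\<lambda>M. M * f"] V Wt H f
      by (simp add: y_def assoc_mult_mat[of _ n r _ m _ 1] assoc_mult_mat[of _ r n _ m _ 1])
    have Ah: "Wt * A * V \<in> carrier_mat r r" using Wt A V by auto
    have "(Wt * A * V) * (Wt * y) = Wt * (A * (V * (Wt * y)))"
      using Wt A V y by (simp add: assoc_mult_mat[of _ r n _ r _ 1] assoc_mult_mat[of _ r n _ n _ r]
          assoc_mult_mat[of _ r n _ n _ 1] assoc_mult_mat[of _ n n _ r _ 1])
    then have 1: "(Wt * A * V) * (Wt * y) = Wt * (A * y)" unfolding Vy .
    have "pencil (Wt * A * V) \<sigma> * (Wt * y) = Wt * y - \<sigma> \<cdot>\<^sub>m ((Wt * A * V) * (Wt * y))"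
      unfolding pencil_def using Ah Wt y
      by (simp add: minus_mult_distrib_mat[of _ r r _ _ 1] mult_smult_assoc_mat[of _ r r _ 1])
    also have "\<dots> = Wt * (S * y)"
      unfolding 1 unfolding S_def pencil_def using A Wt y mult_carrier_mat[OF A y]
      by (simp add: minus_mult_distrib_mat[of _ n n _ _ 1] mult_smult_assoc_mat[of _ n n _ 1]
          mult_minus_distrib_mat[of _ r n _ 1] mult_smult_distrib[of _ r n _ 1])
    finally show ?thesis ..
  qed
  have 1: "R * (B * (e * f)) = y + p \<cdot>\<^sub>m (R * w)"
  proof -
    have "R * (B * (e * f)) = (R * S) * y + p \<cdot>\<^sub>m (R * w)"
      unfolding Bef using R S y w
      by (simp add: mult_add_distrib_mat[of _ n n _ 1] mult_smult_distrib[of _ n n _ 1]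
          assoc_mult_mat[of _ n n _ n _ 1])
    then show ?thesis using RA y by (simp add: S_def)
  qed
  have 2: "V * (Rh * (Wt * (B * (e * f)))) = y + p \<cdot>\<^sub>m (V * (Rh * (Wt * w)))"
  proof -
    have Ah: "pencil (Wt * A * V) \<sigma> \<in> carrier_mat r r" using Wt A V by (intro pencil_carrier) auto
    have Vy: "V * (Wt * y) = y"
      using arg_cong[OF VWH, of "\<lambda>M. M * f"] V Wt H f
      by (simp add: y_def assoc_mult_mat[of _ n r _ m _ 1] assoc_mult_mat[of _ r n _ m _ 1])
    have "Wt * (B * (e * f)) = pencil (Wt * A * V) \<sigma> * (Wt * y) + p \<cdot>\<^sub>m (Wt * w)"
      unfolding Bef using Wt S y w
      by (simp add: mult_add_distrib_mat[of _ r n _ 1] mult_smult_distrib[of _ r n _ 1] Sh)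
    then have "Rh * (Wt * (B * (e * f))) = (Rh * pencil (Wt * A * V) \<sigma>) * (Wt * y) + p \<cdot>\<^sub>m (Rh * (Wt * w))"
      using Rh Ah Wt y w
      by (simp add: mult_add_distrib_mat[of _ r r _ 1] mult_smult_distrib[of _ r r _ 1]
          assoc_mult_mat[of _ r r _ r _ 1])
    then have "Rh * (Wt * (B * (e * f))) = Wt * y + p \<cdot>\<^sub>m (Rh * (Wt * w))"
      unfolding RhA using Wt y by simp
    then show ?thesis using V Wt Rh y w Vy
      by (simp add: mult_add_distrib_mat[of _ n r _ 1] mult_smult_distrib[of _ n r _ 1])
  qed
  have "(R * B - V * Rh * (Wt * B)) * (e * f) = R * (B * (e * f)) - V * (Rh * (Wt * (B * (e * f))))"
    using R B V Rh Wt e f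
    by (simp add: minus_mult_distrib_mat[of _ n 1 _ _ 1] assoc_mult_mat[of _ n n _ 1 _ 1]
       assoc_mult_mat[of _ n r _ 1 _ 1] assoc_mult_mat[of _ n r _ r _ 1] assoc_mult_mat[of _ r r _ 1 _ 1]
       assoc_mult_mat[of _ r n _ 1 _ 1])
  also have "\<dots> = p \<cdot>\<^sub>m (R * w) - p \<cdot>\<^sub>m (V * (Rh * (Wt * w)))"
    unfolding 1 2 using R V Rh Wt w y
    by (intro add_diff_add_mat(2)[of _ n 1]) (auto intro!: mult_carrier_mat[of _ n] mult_carrier_mat[of _ r])
  also have "\<dots> = p \<cdot>\<^sub>m ((R - V * Rh * Wt) * w)"
  proof -
    have "(R - V * Rh * Wt) * w = R * w - V * (Rh * (Wt * w))"
      using R V Rh Wt w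
      by (simp add: minus_mult_distrib_mat[of _ n n _ _ 1] assoc_mult_mat[of _ n r _ n _ 1]
        assoc_mult_mat[of _ n r _ r _ n] assoc_mult_mat[of _ n r _ r _ 1] assoc_mult_mat[of _ r r _ n _ 1])
    then show ?thesis using R V Rh Wt w
      by (intro eq_matI) (auto simp: right_diff_distrib simp del: index_mult_mat(1))
  qed
  finally show ?thesis by (simp add: w_def)
qed

text \<open>
  The identity above with \<open>f\<close> a column of the adjugate of \<open>\<sigma>I - L\<close> and \<open>p\<close> the characteristic
  polynomial; near \<open>\<mu>\<close> one may divide by the scalar \<open>e f(\<sigma>)\<close>.
\<close>

lemma residual_order:
  fixes A :: "complex mat"
  assumes A: "A \<in> carrier_mat n n" and B: "B \<in> carrier_mat n 1" and e: "e \<in> carrier_mat 1 m"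
    and L: "L \<in> carrier_mat m m" and H: "H \<in> carrier_mat n m"
    and V: "V \<in> carrier_mat n r" and Wt: "Wt \<in> carrier_mat r n"
    and HB: "H = B * e + A * H * L" and VWH: "V * (Wt * H) = H"
    and obs: "observable L e" and m: "m > 0"
    and dA: "Determinant.det (pencil A \<mu>) \<noteq> 0"
    and dAh: "Determinant.det (pencil (Wt * A * V) \<mu>) \<noteq> 0"
  shows "\<exists>S X. open S \<and> \<mu> \<in> S \<and> hol_mat n 1 X S \<and>
    (\<forall>\<sigma>\<in>S. Determinant.det (pencil A \<sigma>) \<noteq> 0 \<and> Determinant.det (pencil (Wt * A * V) \<sigma>) \<noteq> 0 \<and>
       pencil_inv A \<sigma> * B - V * pencil_inv (Wt * A * V) \<sigma> * (Wt * B)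
         = (\<sigma> - \<mu>) ^ Polynomial.order \<mu> (char_poly L) \<cdot>\<^sub>m X \<sigma>)"
proof -
  define P where "P = adj_mat (char_poly_matrix L)"
  have cpm: "char_poly_matrix L \<in> carrier_mat m m" by (rule char_poly_matrix_closed[OF L])
  have P: "P \<in> carrier_mat m m" "char_poly_matrix L * P = char_poly L \<cdot>\<^sub>m 1\<^sub>m m"
    using adj_mat[OF cpm] by (auto simp: P_def char_poly_def)
  obtain j where j: "j < m" "poly ((poly_mat e * P) $$ (0, j)) \<mu> \<noteq> 0"
    using observable_adjugate_nonzero[OF L e m obs] unfolding P_def by blast
  define g :: "complex mat" where "g = Matrix.mat m 1 (\<lambda>(i, _). if i = j then 1 else 0)"
  have g: "g \<in> carrier_mat m 1" by (simp add: g_def)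
  have pg: "poly_mat g \<in> carrier_mat m 1" using g by simp
  define f where "f = eval_mat (P * poly_mat g)"
  have Pg: "P * poly_mat g \<in> carrier_mat m 1" using P pg by auto
  have f: "f \<sigma> \<in> carrier_mat m 1" for \<sigma> using Pg by (simp add: f_def)
  define p where "p = char_poly L"
  have fg: "\<sigma> \<cdot>\<^sub>m f \<sigma> = L * f \<sigma> + poly p \<sigma> \<cdot>\<^sub>m g" for \<sigma>
  proof -
    have "char_poly_matrix L * (P * poly_mat g) = p \<cdot>\<^sub>m poly_mat g"
      unfolding assoc_mult_mat[OF cpm P(1) pg, symmetric] P(2) p_def using pg
      by (simp add: mult_smult_assoc_mat[OF one_carrier_mat])
    then have "eval_mat (char_poly_matrix L) \<sigma> * f \<sigma> = eval_mat (p \<cdot>\<^sub>m poly_mat g) \<sigma>"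
      unfolding f_def eval_mat_mult[OF cpm Pg, symmetric] by simp
    also have "eval_mat (char_poly_matrix L) \<sigma> = \<sigma> \<cdot>\<^sub>m 1\<^sub>m m - L"
      using L by (intro eq_matI) (auto simp: char_poly_matrix_def)
    also have "(\<sigma> \<cdot>\<^sub>m 1\<^sub>m m - L) * f \<sigma> = \<sigma> \<cdot>\<^sub>m f \<sigma> - L * f \<sigma>"
      using f[of \<sigma>] L by (simp add: minus_mult_distrib_mat[of _ m m _ _ 1] mult_smult_assoc_mat[OF one_carrier_mat])
    also have "eval_mat (p \<cdot>\<^sub>m poly_mat g) \<sigma> = poly p \<sigma> \<cdot>\<^sub>m g"
      using g by (intro eq_matI) auto
    finally have *: "\<sigma> \<cdot>\<^sub>m f \<sigma> - L * f \<sigma> = poly p \<sigma> \<cdot>\<^sub>m g" .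
    show ?thesis
      unfolding *[symmetric] using f[of \<sigma>] L by (intro eq_matI) (auto simp del: index_mult_mat(1))
  qed
  define u where "u \<sigma> = (e * f \<sigma>) $$ (0, 0)" for \<sigma>
  have u_poly: "u \<sigma> = poly ((poly_mat e * P) $$ (0, j)) \<sigma>" for \<sigma>
  proof -
    have pe: "poly_mat e \<in> carrier_mat 1 m" using e by simp
    have "e * f \<sigma> = eval_mat (poly_mat e) \<sigma> * f \<sigma>"
      using e by (intro arg_cong2[where f = "(*)"] eq_matI) auto
    also have "\<dots> = eval_mat ((poly_mat e * P) * poly_mat g) \<sigma>"
      unfolding f_def eval_mat_mult[OF pe Pg, symmetric] assoc_mult_mat[OF pe P(1) pg] ..
    also have "\<dots> $$ (0, 0) = poly (((poly_mat e * P) * poly_mat g) $$ (0, 0)) \<sigma>"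
      using pe P g by simp
    also have "((poly_mat e * P) * poly_mat g) $$ (0, 0)
        = (\<Sum>i<m. (poly_mat e * P) $$ (0, i) * (if i = j then 1 else 0))"
      using pe P by (simp add: scalar_prod_def lessThan_atLeast0 g_def if_distrib[of "\<lambda>x. [:x:]"] one_pCons
          del: index_mult_mat(1) cong: if_cong) (auto simp: scalar_prod_def intro!: sum.cong)
    also have "\<dots> = (poly_mat e * P) $$ (0, j)" using j(1) by (simp add: if_distrib cong: if_cong)
    finally show ?thesis by (simp add: u_def)
  qed
  have "p \<noteq> 0" using degree_monic_char_poly[OF L] m by (auto simp: p_def)
  then obtain q where q: "p = [:-\<mu>, 1:] ^ Polynomial.order \<mu> p * q" using order_decomp by blast
  define S where "S = {\<sigma>. Determinant.det (pencil A \<sigma>) \<noteq> 0} \<inter> {\<sigma>. Determinant.det (pencil (Wt * A * V) \<sigma>) \<noteq> 0} \<inter> {\<sigma>. u \<sigma> \<noteq> 0}"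
  have Ah: "Wt * A * V \<in> carrier_mat r r" using Wt A V by auto
  have "open {\<sigma>. u \<sigma> \<noteq> 0}" unfolding u_poly by (intro open_Collect_neq continuous_intros)
  then have S: "open S" "\<mu> \<in> S"
    unfolding S_def using open_det_pencil[OF A] open_det_pencil[OF Ah] dA dAh j(2) by (auto simp: u_poly)
  define Y where "Y \<sigma> = (pencil_inv A \<sigma> - V * pencil_inv (Wt * A * V) \<sigma> * Wt) * (A * (H * g))" for \<sigma>
  have RA: "hol_mat n n (pencil_inv A) S" by (rule hol_mat_pencil_inv[OF A]) (auto simp: S_def)
  have RAh: "hol_mat r r (pencil_inv (Wt * A * V)) S" by (rule hol_mat_pencil_inv[OF Ah]) (auto simp: S_def)
  have Y: "hol_mat n 1 Y S"
    unfolding Y_def using A H g V Wt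
    by (intro hol_mat_mult[of _ n] hol_mat_diff RA hol_mat_mult[of _ r] hol_mat_const RAh) auto
  define X where "X \<sigma> = (poly q \<sigma> / u \<sigma>) \<cdot>\<^sub>m Y \<sigma>" for \<sigma>
  have X: "hol_mat n 1 X S"
    unfolding X_def by (intro hol_mat_smult Y) (auto simp: u_poly S_def intro!: holomorphic_intros)
  have "pencil_inv A \<sigma> * B - V * pencil_inv (Wt * A * V) \<sigma> * (Wt * B)
         = (\<sigma> - \<mu>) ^ Polynomial.order \<mu> p \<cdot>\<^sub>m X \<sigma>" (is "?res = _") if s: "\<sigma> \<in> S" for \<sigma>
  proof -
    have d: "Determinant.det (pencil A \<sigma>) \<noteq> 0" "Determinant.det (pencil (Wt * A * V) \<sigma>) \<noteq> 0" "u \<sigma> \<noteq> 0"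
      using s by (auto simp: S_def)
    note Rc = pencil_inv_carrier[OF A] and Rhc = pencil_inv_carrier[OF Ah]
    have res: "?res \<in> carrier_mat n 1"
      using A B V Wt Rc[of \<sigma>] Rhc[of \<sigma>] by (auto intro!: minus_carrier_mat)
    have "?res * (e * f \<sigma>) = poly p \<sigma> \<cdot>\<^sub>m Y \<sigma>"
      unfolding Y_def
      by (rule residual_identity[OF A B e L H V Wt Rc Rhc f g HB VWH pencil_inv(2)[OF A d(1)] pencil_inv(2)[OF Ah d(2)] fg])
    also have "?res * (e * f \<sigma>) = u \<sigma> \<cdot>\<^sub>m ?res"
      unfolding u_def by (rule mult_scalar_mat[OF res]) (use e f in auto)
    finally have "(1 / u \<sigma>) \<cdot>\<^sub>m (u \<sigma> \<cdot>\<^sub>m ?res) = (1 / u \<sigma>) \<cdot>\<^sub>m (poly p \<sigma> \<cdot>\<^sub>m Y \<sigma>)" by simp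
    then have "?res = (poly p \<sigma> / u \<sigma>) \<cdot>\<^sub>m Y \<sigma>"
      unfolding smult_smult_times using d(3) by (simp add: one_smult_mat)
    also have "poly p \<sigma> = (\<sigma> - \<mu>) ^ Polynomial.order \<mu> p * poly q \<sigma>"
      by (subst q) (simp add: algebra_simps)
    finally show ?thesis by (simp add: X_def smult_smult_times)
  qed
  then show ?thesis using S X unfolding p_def by (intro exI[of _ S] exI[of _ X]) (auto simp: S_def)
qed

section \<open>Order of the transfer function error\<close>

text \<open>
  Biorthogonality of the two bases makes compression and forming the pencil commute.
\<close>

lemma projected_pencil:
  fixes A :: "complex mat"
  assumes A: "A \<in> carrier_mat n n" and V: "V \<in> carrier_mat n r" and Wt: "Wt \<in> carrier_mat r n"
    and WV: "Wt * V = 1\<^sub>m r"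
  shows "Wt * (pencil A \<sigma> * V) = pencil (Wt * A * V) \<sigma>"
proof -
  have "pencil A \<sigma> * V = V - \<sigma> \<cdot>\<^sub>m (A * V)"
    unfolding pencil_def using A V
    by (simp add: minus_mult_distrib_mat[of _ n n _ _ r] mult_smult_assoc_mat[of _ n n _ r])
  then have "Wt * (pencil A \<sigma> * V) = Wt * V - \<sigma> \<cdot>\<^sub>m (Wt * (A * V))"
    using A V Wt by (simp add: mult_minus_distrib_mat[of _ r n _ r] mult_smult_distrib[of _ r n _ r])
  then show ?thesis unfolding WV pencil_def using A V Wt by (simp add: assoc_mult_mat[of _ r n _ n _ r])
qed

text \<open>
  For \<open>S = I - \<sigma>A\<close>. Multiplying out, the two mixed terms cancel because \<open>Rh\<close> inverts
  \<open>Wt S V\<close>, the compression of \<open>S\<close> to the reduced space.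
\<close>

lemma error_eq_residual_product:
  fixes B :: "'a::comm_ring_1 mat"
  assumes B: "B \<in> carrier_mat n 1" and C: "C \<in> carrier_mat 1 n"
    and V: "V \<in> carrier_mat n r" and Wt: "Wt \<in> carrier_mat r n"
    and R: "R \<in> carrier_mat n n" and Rh: "Rh \<in> carrier_mat r r" and S: "S \<in> carrier_mat n n"
    and RS: "R * S = 1\<^sub>m n" and SR: "S * R = 1\<^sub>m n" and RhS: "Rh * (Wt * (S * V)) = 1\<^sub>m r"
  shows "(C * R - C * V * Rh * Wt) * (S * (R * B - V * Rh * (Wt * B)))
       = C * R * B - C * V * Rh * (Wt * B)"
proof -
  define x where "x = Rh * (Wt * B)"
  have x: "x \<in> carrier_mat r 1" using Rh Wt B by (simp add: x_def)
  have Ch: "C * V * Rh \<in> carrier_mat 1 r" using C V Rh by auto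
  have SRB: "S * (R * B) = B" unfolding assoc_mult_mat[OF S R B, symmetric] SR by (rule left_mult_one_mat[OF B])
  have 1: "S * (R * B - V * Rh * (Wt * B)) = B - S * (V * x)"
    using S R B V Rh Wt SRB
    by (simp add: x_def mult_minus_distrib_mat[of _ n n _ 1] assoc_mult_mat[of _ n r _ r _ 1])
  have 2: "C * R * (S * (V * x)) = C * (V * x)"
  proof -
    have "C * R * (S * (V * x)) = C * ((R * S) * (V * x))"
      using C R S V x by (simp add: assoc_mult_mat[of _ 1 n _ n _ 1] assoc_mult_mat[of _ n n _ n _ 1])
    then show ?thesis using RS V x by simp
  qed
  have 3: "C * V * Rh * Wt * (S * (V * x)) = C * (V * x)"
  proof -
    have "C * V * Rh * Wt * (S * (V * x)) = C * V * ((Rh * (Wt * (S * V))) * x)"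
      using C V Rh Wt S x
      by (simp add: assoc_mult_mat[of _ 1 r _ n _ 1] assoc_mult_mat[of _ 1 r _ r _ 1] assoc_mult_mat[of _ 1 n _ r _ 1]
         assoc_mult_mat[of _ r r _ r _ 1] assoc_mult_mat[of _ r n _ r _ 1] assoc_mult_mat[of _ n n _ r _ 1]
         assoc_mult_mat[of _ n r _ r _ 1])
    then show ?thesis using RhS C V x by (simp add: assoc_mult_mat[of _ 1 n _ r _ 1])
  qed
  have 4: "C * V * Rh * Wt * B = C * V * Rh * (Wt * B)"
    using C V Rh Wt B by (simp add: assoc_mult_mat[of _ 1 r _ n _ 1])
  have cancel: "(X - Y) - (W - W) = X - Y"
    if "X \<in> carrier_mat 1 1" "Y \<in> carrier_mat 1 1" "W \<in> carrier_mat 1 1" for X Y W :: "'a mat"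
    using that by (intro eq_matI) auto
  have y: "S * (V * x) \<in> carrier_mat n 1" using S V x by auto
  have CR: "C * R \<in> carrier_mat 1 n" and CW: "C * V * Rh * Wt \<in> carrier_mat 1 n"
    using C R V Rh Wt by auto
  have CRB: "C * R * B \<in> carrier_mat 1 1" and CWB: "C * V * Rh * (Wt * B) \<in> carrier_mat 1 1"
    and CVx: "C * (V * x) \<in> carrier_mat 1 1"
    using CR B Ch Wt C V x by auto
  have "(C * R - C * V * Rh * Wt) * (B - S * (V * x))
      = (C * R * B - C * V * Rh * Wt * B) - (C * R * (S * (V * x)) - C * V * Rh * Wt * (S * (V * x)))"
    unfolding mult_minus_distrib_mat[OF minus_carrier_mat[OF CW] B y]
      minus_mult_distrib_mat[OF CR CW B] minus_mult_distrib_mat[OF CR CW y] ..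
  also have "\<dots> = C * R * B - C * V * Rh * (Wt * B)"
    unfolding 2 3 4 by (rule cancel[OF CRB CWB CVx])
  finally show ?thesis unfolding 1 .
qed

text \<open>
  The data \<open>e', L', H'\<close> belong to the transposed system, for which \<open>Wt\<^sup>T\<close> and \<open>V\<^sup>T\<close> exchange their
  roles; transposing its right residual gives the left residual of the original system.
\<close>

lemma transfer_error_order:
  fixes A :: "complex mat"
  assumes A: "A \<in> carrier_mat n n" and B: "B \<in> carrier_mat n 1" and C: "C \<in> carrier_mat 1 n"
    and V: "V \<in> carrier_mat n r" and Wt: "Wt \<in> carrier_mat r n" and WV: "Wt * V = 1\<^sub>m r"
    and e: "e \<in> carrier_mat 1 m" and L: "L \<in> carrier_mat m m" and H: "H \<in> carrier_mat n m"
    and HB: "H = B * e + A * H * L" and VWH: "V * (Wt * H) = H" and obs: "observable L e" and m: "m > 0"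
    and e': "e' \<in> carrier_mat 1 m'" and L': "L' \<in> carrier_mat m' m'" and H': "H' \<in> carrier_mat n m'"
    and HC: "H' = transpose_mat C * e' + transpose_mat A * H' * L'"
    and WVH: "transpose_mat Wt * (transpose_mat V * H') = H'" and obs': "observable L' e'" and m': "m' > 0"
    and dA: "Determinant.det (pencil A \<mu>) \<noteq> 0"
    and dAh: "Determinant.det (pencil (Wt * A * V) \<mu>) \<noteq> 0"
  shows "\<exists>S h. open S \<and> \<mu> \<in> S \<and> h holomorphic_on S \<and>
    (\<forall>\<sigma>\<in>S. Determinant.det (pencil A \<sigma>) \<noteq> 0 \<and> Determinant.det (pencil (Wt * A * V) \<sigma>) \<noteq> 0 \<and>
       (C * pencil_inv A \<sigma> * B) $$ (0, 0) - (C * V * pencil_inv (Wt * A * V) \<sigma> * (Wt * B)) $$ (0, 0)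
         = (\<sigma> - \<mu>) ^ (Polynomial.order \<mu> (char_poly L) + Polynomial.order \<mu> (char_poly L')) * h \<sigma>)"
proof -
  have Ah: "Wt * A * V \<in> carrier_mat r r" using Wt A V by auto
  have AhT: "transpose_mat V * transpose_mat A * transpose_mat Wt = transpose_mat (Wt * A * V)"
    using V A Wt mult_carrier_mat[OF Wt A]
    by (simp add: transpose_mult[of _ r n _ r] transpose_mult[of _ r n _ n] del: assoc_mult_mat)
      (simp add: assoc_mult_mat[of _ r n _ n _ r])
  define k where "k = Polynomial.order \<mu> (char_poly L)"
  define k' where "k' = Polynomial.order \<mu> (char_poly L')"
  obtain S X where S: "open S" "\<mu> \<in> S" and X: "hol_mat n 1 X S" and right:
    "\<And>\<sigma>. \<sigma> \<in> S \<Longrightarrow> Determinant.det (pencil A \<sigma>) \<noteq> 0 \<and> Determinant.det (pencil (Wt * A * V) \<sigma>) \<noteq> 0 \<and>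
       pencil_inv A \<sigma> * B - V * pencil_inv (Wt * A * V) \<sigma> * (Wt * B) = (\<sigma> - \<mu>) ^ k \<cdot>\<^sub>m X \<sigma>"
    using residual_order[OF A B e L H V Wt HB VWH obs m dA dAh] unfolding k_def by blast
  have "Determinant.det (pencil (transpose_mat A) \<mu>) \<noteq> 0"
     "Determinant.det (pencil (transpose_mat V * transpose_mat A * transpose_mat Wt) \<mu>) \<noteq> 0"
    unfolding AhT using dA dAh det_pencil_transpose[OF A] det_pencil_transpose[OF Ah] by auto
  from residual_order[OF _ _ e' L' H' _ _ HC WVH obs' m' this] A C V Wt
  obtain S' Y where S': "open S'" "\<mu> \<in> S'" and Y: "hol_mat n 1 Y S'" and left:
    "\<And>\<sigma>. \<sigma> \<in> S' \<Longrightarrow> pencil_inv (transpose_mat A) \<sigma> * transpose_mat C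
        - transpose_mat Wt * pencil_inv (transpose_mat (Wt * A * V)) \<sigma> * (transpose_mat V * transpose_mat C)
        = (\<sigma> - \<mu>) ^ k' \<cdot>\<^sub>m Y \<sigma>"
    unfolding AhT k'_def by (metis transpose_carrier_mat)
  define T where "T = S \<inter> S'"
  define h where "h \<sigma> = (transpose_mat (Y \<sigma>) * (pencil A \<sigma> * X \<sigma>)) $$ (0, 0)" for \<sigma>
  have hol: "h holomorphic_on T" unfolding h_def
    by (rule hol_mat_entry[of 1 1], rule hol_mat_mult[of _ n], rule hol_mat_transpose, rule hol_mat_subset[OF Y],
        simp add: T_def, rule hol_mat_mult[OF hol_mat_pencil[OF A]], rule hol_mat_subset[OF X])
      (auto simp: T_def)
  have "(C * pencil_inv A \<sigma> * B) $$ (0, 0) - (C * V * pencil_inv (Wt * A * V) \<sigma> * (Wt * B)) $$ (0, 0)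
         = (\<sigma> - \<mu>) ^ (k + k') * h \<sigma>" if s: "\<sigma> \<in> T" for \<sigma>
  proof -
    define R where "R = pencil_inv A \<sigma>"
    define Rh where "Rh = pencil_inv (Wt * A * V) \<sigma>"
    have d: "Determinant.det (pencil A \<sigma>) \<noteq> 0" "Determinant.det (pencil (Wt * A * V) \<sigma>) \<noteq> 0"
      using right s by (auto simp: T_def)
    have R: "R \<in> carrier_mat n n" and Rh: "Rh \<in> carrier_mat r r"
      using pencil_inv_carrier[OF A] pencil_inv_carrier[OF Ah] by (auto simp: R_def Rh_def)
    have Xs: "X \<sigma> \<in> carrier_mat n 1" and Ys: "Y \<sigma> \<in> carrier_mat n 1"
      using hol_mat_carrier[OF X] hol_mat_carrier[OF Y] s by (auto simp: T_def)
    have P: "pencil A \<sigma> \<in> carrier_mat n n" by (rule pencil_carrier[OF A])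
    have l: "transpose_mat R * transpose_mat C - transpose_mat Wt * transpose_mat Rh * (transpose_mat V * transpose_mat C)
        = (\<sigma> - \<mu>) ^ k' \<cdot>\<^sub>m Y \<sigma>"
      using left[of \<sigma>] s unfolding R_def Rh_def T_def
        pencil_inv_transpose[OF A d(1)] pencil_inv_transpose[OF Ah d(2)] by simp
    have "C * R - C * V * Rh * Wt = transpose_mat (transpose_mat R * transpose_mat C - transpose_mat Wt * transpose_mat Rh * (transpose_mat V * transpose_mat C))"
    proof -
      have "transpose_mat R * transpose_mat C = transpose_mat (C * R)"
        using transpose_mult[OF C R] by simp
      moreover have "transpose_mat Wt * transpose_mat Rh * (transpose_mat V * transpose_mat C) = transpose_mat (C * V * Rh * Wt)"
        using C V Rh Wt mult_carrier_mat[OF C V] mult_carrier_mat[OF mult_carrier_mat[OF C V] Rh]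
        by (simp add: transpose_mult[of _ 1 r _ n] transpose_mult[of _ 1 r _ r] transpose_mult[of _ 1 n _ r]
            assoc_mult_mat[of _ n r _ r _ 1] del: assoc_mult_mat)
      ultimately show ?thesis using C R V Rh Wt by (intro eq_matI) auto
    qed
    then have l': "C * R - C * V * Rh * Wt = (\<sigma> - \<mu>) ^ k' \<cdot>\<^sub>m transpose_mat (Y \<sigma>)"
      unfolding l using Ys by (intro eq_matI) auto
    have r': "R * B - V * Rh * (Wt * B) = (\<sigma> - \<mu>) ^ k \<cdot>\<^sub>m X \<sigma>"
      using right s by (auto simp: R_def Rh_def T_def)
    have "C * R * B - C * V * Rh * (Wt * B) = ((\<sigma> - \<mu>) ^ k' \<cdot>\<^sub>m transpose_mat (Y \<sigma>)) * (pencil A \<sigma> * ((\<sigma> - \<mu>) ^ k \<cdot>\<^sub>m X \<sigma>))"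
      unfolding l'[symmetric] r'[symmetric]
    proof (rule error_eq_residual_product[symmetric, OF B C V Wt R Rh P])
      show "R * pencil A \<sigma> = 1\<^sub>m n" "pencil A \<sigma> * R = 1\<^sub>m n" unfolding R_def by (rule pencil_inv[OF A d(1)])+
      show "Rh * (Wt * (pencil A \<sigma> * V)) = 1\<^sub>m r"
        unfolding Rh_def projected_pencil[OF A V Wt WV] by (rule pencil_inv(2)[OF Ah d(2)])
    qed
    also have "\<dots> = (\<sigma> - \<mu>) ^ (k + k') \<cdot>\<^sub>m (transpose_mat (Y \<sigma>) * (pencil A \<sigma> * X \<sigma>))"
      using Xs Ys P by (simp add: mult_smult_distrib[of _ n n _ 1] mult_smult_distrib[of _ 1 n _ 1]
          mult_smult_assoc_mat[of _ 1 n _ 1] smult_smult_times power_add mult.commute)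
    finally have "(C * R * B - C * V * Rh * (Wt * B)) $$ (0, 0) = (\<sigma> - \<mu>) ^ (k + k') * h \<sigma>"
      using Xs Ys P by (simp add: h_def del: index_mult_mat(1))
    then show ?thesis using C R B V Rh Wt by (simp add: R_def Rh_def del: index_mult_mat(1))
  qed
  then show ?thesis unfolding k_def[symmetric] k'_def[symmetric]
    using S S' hol right by (intro exI[of _ T] exI[of _ h]) (auto simp: T_def)
qed

section \<open>From a zero of the error to interpolation\<close>

text \<open>
  Differentiation lowers the order of the zero by one and keeps the shape of the factorisation,
  which makes the induction work for an arbitrary cofactor \<open>h\<close>.
\<close>

lemma higher_deriv_zero_of_factor:
  assumes "open S" "z0 \<in> S" "h holomorphic_on S" "\<And>z. z \<in> S \<Longrightarrow> f z = (z - z0) ^ k * h z" "i < k"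
  shows "(deriv ^^ i) f z0 = 0"
  using assms(3-5)
proof (induction i arbitrary: f h k)
  case 0
  then show ?case using assms(2) by simp
next
  case (Suc i)
  obtain k' where k: "k = Suc k'" using Suc.prems(3) by (cases k) auto
  define h' where "h' z = of_nat k * h z + (z - z0) * deriv h z" for z
  have "h' holomorphic_on S"
    unfolding h'_def using Suc.prems(1) assms(1) by (intro holomorphic_intros) auto
  moreover have "deriv f z = (z - z0) ^ k' * h' z" if z: "z \<in> S" for z
  proof -
    have dh: "(h has_field_derivative deriv h z) (at z)"
      using Suc.prems(1) assms(1) z holomorphic_derivI by blast
    have "((\<lambda>z. (z - z0) ^ k * h z) has_field_derivative (z - z0) ^ k' * h' z) (at z)"
      unfolding h'_def k by (rule derivative_eq_intros dh refl | simp)+ (simp add: algebra_simps)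
    then have "(f has_field_derivative (z - z0) ^ k' * h' z) (at z)"
      by (rule has_field_derivative_transform_within_open[OF _ assms(1) z]) (use Suc.prems(2) in auto)
    then show ?thesis by (rule DERIV_imp_deriv)
  qed
  ultimately have "(deriv ^^ i) (deriv f) z0 = 0"
    using Suc.prems(3) k by (intro Suc.IH[of h' _ k']) auto
  then show ?case by (simp add: funpow_Suc_right del: funpow.simps)
qed

text \<open>
  The equation is needed only away from \<open>0\<close>, so that \<open>\<sigma>\<close> can be cancelled in the induction step.
\<close>

lemma poly_coeff_zero_of_factor:
  fixes P :: "complex poly"
  assumes "isCont h 0" "\<forall>\<^sub>F \<sigma> in at 0. poly P \<sigma> = \<sigma> ^ k * h \<sigma>" "i < k"
  shows "coeff P i = 0"
  using assms(2,3)
proof (induction k arbitrary: P i)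
  case (Suc k)
  obtain a Q where P: "P = pCons a Q" by (cases P) auto
  have "((\<lambda>\<sigma>. \<sigma> ^ Suc k * h \<sigma>) \<longlongrightarrow> 0 ^ Suc k * h 0) (at 0)"
    using assms(1) unfolding isCont_def by (intro tendsto_intros)
  then have "(poly P \<longlongrightarrow> 0) (at 0)"
    using Lim_transform_eventually[of "\<lambda>\<sigma>. \<sigma> ^ Suc k * h \<sigma>" 0 "at 0" "poly P"] Suc.prems(1)
    by (simp add: eq_commute)
  moreover have "(poly P \<longlongrightarrow> poly P 0) (at 0)" using poly_isCont isCont_def by blast
  ultimately have "a = 0" using tendsto_unique[of "at (0::complex)"] by (fastforce simp: P)
  have "\<forall>\<^sub>F \<sigma> in at 0. poly Q \<sigma> = \<sigma> ^ k * h \<sigma>"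
    using Suc.prems(1) eventually_neq_at_within[of 0 0 UNIV]
    by eventually_elim (simp add: P \<open>a = 0\<close>)
  from Suc.IH[OF this] show ?case
    using \<open>a = 0\<close> Suc.prems(2) by (cases i) (auto simp: P)
qed simp

lemma transfer_eq_pencil_inv:
  assumes A: "A \<in> carrier_mat n n" and B: "B \<in> carrier_mat n 1" and C: "C \<in> carrier_mat 1 n"
    and z: "z \<noteq> 0" and d: "Determinant.det (pencil A (inverse z)) \<noteq> 0"
  shows "transfer A B C z = inverse z * (C * pencil_inv A (inverse z) * B) $$ (0, 0)"
proof -
  define R where "R = pencil_inv A (inverse z)"
  have R: "R \<in> carrier_mat n n" unfolding R_def by (rule pencil_inv_carrier[OF A])
  have "z \<cdot>\<^sub>m 1\<^sub>m n - A = z \<cdot>\<^sub>m pencil A (inverse z)"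
    using A z by (intro eq_matI) (auto simp: pencil_def algebra_simps)
  then have "(z \<cdot>\<^sub>m 1\<^sub>m n - A) * (inverse z \<cdot>\<^sub>m R) = (z * inverse z) \<cdot>\<^sub>m (pencil A (inverse z) * R)"
    using pencil_carrier[OF A, of "inverse z"] R
    by (simp add: mult_smult_distrib[of _ n n _ n] mult_smult_assoc_mat[of _ n n _ n] smult_smult_times mult.commute)
  also have "\<dots> = 1\<^sub>m n" unfolding R_def pencil_inv(1)[OF A d] using z by (simp add: one_smult_mat)
  finally have "mat_inverse (z \<cdot>\<^sub>m 1\<^sub>m n - A) = Some (inverse z \<cdot>\<^sub>m R)"
    by (intro mat_inverse_eq[of _ n]) (use A R in \<open>auto intro!: minus_carrier_mat\<close>)
  moreover have "dim_row A = n" using A by simp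
  ultimately have "transfer A B C z = (C * (inverse z \<cdot>\<^sub>m R) * B) $$ (0, 0)"
    by (simp add: transfer_def)
  also have "C * (inverse z \<cdot>\<^sub>m R) * B = inverse z \<cdot>\<^sub>m (C * R * B)"
    using mult_smult_distrib[OF C R] mult_smult_assoc_mat[OF mult_carrier_mat[OF C R] B] by simp
  also have "\<dots> $$ (0, 0) = inverse z * (C * R * B) $$ (0, 0)"
    using B C by simp
  finally show ?thesis by (simp add: R_def)
qed

lemma transfer_holomorphic:
  assumes A: "A \<in> carrier_mat n n" and B: "B \<in> carrier_mat n 1" and C: "C \<in> carrier_mat 1 n"
    and T: "\<And>z. z \<in> T \<Longrightarrow> z \<noteq> 0 \<and> Determinant.det (pencil A (inverse z)) \<noteq> 0"
  shows "transfer A B C holomorphic_on T"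
proof (rule holomorphic_transform)
  show "(\<lambda>z. inverse z * (C * pencil_inv A (inverse z) * B) $$ (0, 0)) holomorphic_on T"
  proof (intro holomorphic_intros)
    have "hol_mat n n (pencil_inv A) (inverse ` T)"
      by (rule hol_mat_pencil_inv[OF A]) (use T in auto)
    then have "hol_mat 1 1 (\<lambda>\<sigma>. C * pencil_inv A \<sigma> * B) (inverse ` T)"
      using B C by (intro hol_mat_mult[of _ n] hol_mat_const) auto
    then have "(\<lambda>\<sigma>. (C * pencil_inv A \<sigma> * B) $$ (0, 0)) holomorphic_on inverse ` T"
      by (rule hol_mat_entry) auto
    then have "((\<lambda>\<sigma>. (C * pencil_inv A \<sigma> * B) $$ (0, 0)) \<circ> inverse) holomorphic_on T"
      by (intro holomorphic_on_compose holomorphic_intros) (use T in auto)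
    then show "(\<lambda>z. (C * pencil_inv A (inverse z) * B) $$ (0, 0)) holomorphic_on T"
      by (simp add: o_def)
  qed (use T in auto)
qed (use T transfer_eq_pencil_inv[OF A B C] in auto)

text \<open>
  Geometric expansion of the resolvent at \<open>z = \<infinity>\<close> with the remainder in closed form.
\<close>

lemma markov_expansion:
  assumes A: "A \<in> carrier_mat n n" and B: "B \<in> carrier_mat n 1" and C: "C \<in> carrier_mat 1 n"
    and d: "Determinant.det (pencil A \<sigma>) \<noteq> 0"
  shows "(C * pencil_inv A \<sigma> * B) $$ (0, 0) = (\<Sum>j<k. \<sigma> ^ j * (C * A ^\<^sub>m j * B) $$ (0, 0))
           + \<sigma> ^ k * (C * A ^\<^sub>m k * pencil_inv A \<sigma> * B) $$ (0, 0)"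
proof (induction k)
  case 0
  then show ?case using A C by simp
next
  case (Suc k)
  define M where "M = C * A ^\<^sub>m k"
  define R where "R = pencil_inv A \<sigma>"
  have M: "M \<in> carrier_mat 1 n" using C pow_carrier_mat[OF A] by (simp add: M_def)
  have R: "R \<in> carrier_mat n n" unfolding R_def by (rule pencil_inv_carrier[OF A])
  have "pencil A \<sigma> * R = R - \<sigma> \<cdot>\<^sub>m (A * R)"
    unfolding pencil_def using A R
    by (simp add: minus_mult_distrib_mat[of _ n n _ _ n] mult_smult_assoc_mat[of _ n n _ n])
  then have "R - \<sigma> \<cdot>\<^sub>m (A * R) = 1\<^sub>m n" using pencil_inv(1)[OF A d] by (simp add: R_def)
  then have R1: "R = 1\<^sub>m n + \<sigma> \<cdot>\<^sub>m (A * R)"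
  proof -
    have "R = (R - \<sigma> \<cdot>\<^sub>m (A * R)) + \<sigma> \<cdot>\<^sub>m (A * R)" using A R by (intro eq_matI) auto
    then show ?thesis using \<open>R - \<sigma> \<cdot>\<^sub>m (A * R) = 1\<^sub>m n\<close> by simp
  qed
  have AR: "A * R \<in> carrier_mat n n" using A R by simp
  have "M * R = M * (1\<^sub>m n + \<sigma> \<cdot>\<^sub>m (A * R))" using R1 by simp
  also have "\<dots> = M + \<sigma> \<cdot>\<^sub>m (M * (A * R))"
    using M AR by (simp add: mult_add_distrib_mat[of _ 1 n _ n] mult_smult_distrib[of _ 1 n _ n])
  finally have "M * R * B = M * B + \<sigma> \<cdot>\<^sub>m (M * (A * R) * B)"
    using M AR B by (simp add: add_mult_distrib_mat[of _ 1 n _ _ 1] mult_smult_assoc_mat[of _ 1 n _ 1] del: assoc_mult_mat)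
  then have "(M * R * B) $$ (0, 0) = (M * B) $$ (0, 0) + \<sigma> * (M * (A * R) * B) $$ (0, 0)"
    using M AR B by (simp del: assoc_mult_mat index_mult_mat(1))
  moreover have "M * (A * R) = C * A ^\<^sub>m Suc k * R"
    unfolding M_def pow_mat.simps
    using assoc_mult_mat[OF C pow_carrier_mat[OF A, of k] AR]
      assoc_mult_mat[OF pow_carrier_mat[OF A, of k] A R]
      assoc_mult_mat[OF C mult_carrier_mat[OF pow_carrier_mat[OF A, of k] A] R] by simp
  moreover have "(C * R * B) $$ (0, 0) = (\<Sum>j<k. \<sigma> ^ j * (C * A ^\<^sub>m j * B) $$ (0, 0))
           + \<sigma> ^ k * (M * R * B) $$ (0, 0)"
    using Suc by (simp only: R_def M_def)
  ultimately show ?case unfolding R_def[symmetric]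
    by (simp add: algebra_simps M_def del: pow_mat.simps index_mult_mat(1) assoc_mult_mat)
qed

text \<open>
  For \<open>\<mu> \<noteq> 0\<close> the substitution \<open>\<sigma> = 1/z\<close> turns \<open>(\<sigma> - \<mu>)\<^sup>k\<close> into \<open>(z - 1/\<mu>)\<^sup>k\<close> times a function that is
  holomorphic near \<open>1/\<mu>\<close>. For \<open>\<mu> = 0\<close> the remainders of the Markov expansions are absorbed into the
  cofactor, and the remaining polynomial of degree below \<open>k\<close> has to vanish.
\<close>

lemma interpolates_of_error_order:
  assumes A: "A \<in> carrier_mat n n" and B: "B \<in> carrier_mat n 1" and C: "C \<in> carrier_mat 1 n"
    and Ah: "Ah \<in> carrier_mat r r" and Bh: "Bh \<in> carrier_mat r 1" and Ch: "Ch \<in> carrier_mat 1 r"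
    and S: "open S" "\<mu> \<in> S" and h: "h holomorphic_on S"
    and err: "\<forall>\<sigma>\<in>S. Determinant.det (pencil A \<sigma>) \<noteq> 0 \<and> Determinant.det (pencil Ah \<sigma>) \<noteq> 0 \<and>
       (C * pencil_inv A \<sigma> * B) $$ (0, 0) - (Ch * pencil_inv Ah \<sigma> * Bh) $$ (0, 0) = (\<sigma> - \<mu>) ^ k * h \<sigma>"
  shows "interpolates Ah Bh Ch A B C \<mu> k"
proof (cases "\<mu> = 0")
  case False
  define z0 where "z0 = inverse \<mu>"
  define T where "T = {z. z \<noteq> 0 \<and> inverse z \<in> S}"
  have "open (- {0 :: complex} \<inter> inverse -` S)"
    using S by (intro continuous_open_preimage continuous_intros) auto
  then have T: "open T" by (simp add: T_def vimage_def Int_def conj_commute)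
  have z0: "z0 \<in> T" "z0 \<noteq> 0" using S False by (auto simp: T_def z0_def)
  have TA: "z \<noteq> 0 \<and> Determinant.det (pencil A (inverse z)) \<noteq> 0"
    and TAh: "z \<noteq> 0 \<and> Determinant.det (pencil Ah (inverse z)) \<noteq> 0" if "z \<in> T" for z
    using that err by (auto simp: T_def)
  have hol: "transfer A B C holomorphic_on T" "transfer Ah Bh Ch holomorphic_on T"
    using transfer_holomorphic[OF A B C] transfer_holomorphic[OF Ah Bh Ch] TA TAh by blast+
  \<comment> \<open>From \<open>1/z - \<mu> = (z - 1/\<mu>) (- \<mu>/z)\<close> and the factor \<open>\<sigma> = 1/z\<close> in \<open>G(z) = \<sigma> C R(\<sigma>) B\<close>.\<close>
  define g where "g z = (-\<mu>) ^ k * inverse z ^ Suc k * h (inverse z)" for z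
  have "h holomorphic_on inverse ` T" using h by (rule holomorphic_on_subset) (auto simp: T_def)
  then have "(h \<circ> inverse) holomorphic_on T"
    by (intro holomorphic_on_compose holomorphic_intros) (auto simp: T_def)
  then have g: "g holomorphic_on T"
    unfolding g_def by (intro holomorphic_intros) (auto simp: T_def o_def)
  have fac: "transfer A B C z - transfer Ah Bh Ch z = (z - z0) ^ k * g z" if z: "z \<in> T" for z
  proof -
    have "transfer A B C z - transfer Ah Bh Ch z = inverse z * ((inverse z - \<mu>) ^ k * h (inverse z))"
      using z err transfer_eq_pencil_inv[OF A B C] transfer_eq_pencil_inv[OF Ah Bh Ch] TA[OF z] TAh[OF z]
      by (auto simp: T_def right_diff_distrib[symmetric] simp del: index_mult_mat(1))
    also have "inverse z - \<mu> = (z - z0) * (- \<mu> * inverse z)"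
      using TA[OF z] False by (simp add: z0_def field_simps)
    finally show ?thesis unfolding g_def power_mult_distrib by (simp add: mult_ac)
  qed
  have "(deriv ^^ i) (transfer A B C) z0 = (deriv ^^ i) (transfer Ah Bh Ch) z0" if i: "i < k" for i
  proof -
    have "(deriv ^^ i) (\<lambda>z. transfer A B C z - transfer Ah Bh Ch z) z0 = 0"
      by (rule higher_deriv_zero_of_factor[OF T z0(1) g fac i])
    moreover have "(deriv ^^ i) (\<lambda>z. transfer A B C z - transfer Ah Bh Ch z) z0
        = (deriv ^^ i) (transfer A B C) z0 - (deriv ^^ i) (transfer Ah Bh Ch) z0"
      by (rule higher_deriv_diff[OF hol T z0(1)])
    ultimately show ?thesis by simp
  qed
  then show ?thesis using False by (simp add: interpolates_def z0_def)
next
  case True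
  define M where "M j = (C * A ^\<^sub>m j * B) $$ (0, 0) - (Ch * Ah ^\<^sub>m j * Bh) $$ (0, 0)" for j
  \<comment> \<open>The differences of the first \<open>k\<close> Markov parameters as coefficients.\<close>
  define P where "P = (\<Sum>j<k. monom (M j) j)"
  define g where "g \<sigma> = h \<sigma> - (C * A ^\<^sub>m k * pencil_inv A \<sigma> * B) $$ (0, 0)
      + (Ch * Ah ^\<^sub>m k * pencil_inv Ah \<sigma> * Bh) $$ (0, 0)" for \<sigma>
  have "hol_mat n n (pencil_inv A) S" "hol_mat r r (pencil_inv Ah) S"
    using hol_mat_pencil_inv[OF A] hol_mat_pencil_inv[OF Ah] err by auto
  then have "hol_mat 1 1 (\<lambda>\<sigma>. C * A ^\<^sub>m k * pencil_inv A \<sigma> * B) S"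
     "hol_mat 1 1 (\<lambda>\<sigma>. Ch * Ah ^\<^sub>m k * pencil_inv Ah \<sigma> * Bh) S"
    using A B C Ah Bh Ch
    by (intro hol_mat_mult[of _ n] hol_mat_mult[of _ r] hol_mat_const mult_carrier_mat pow_carrier_mat; simp)+
  from this[THEN hol_mat_entry, of 0 0] h have "g holomorphic_on S"
    unfolding g_def by (intro holomorphic_intros) (auto simp del: index_mult_mat(1))
  then have g: "isCont g 0"
    using S True holomorphic_on_imp_continuous_on continuous_on_eq_continuous_at by blast
  have fac: "poly P \<sigma> = \<sigma> ^ k * g \<sigma>" if "\<sigma> \<in> S" for \<sigma>
  proof -
    have d: "Determinant.det (pencil A \<sigma>) \<noteq> 0" "Determinant.det (pencil Ah \<sigma>) \<noteq> 0" using that err by auto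
    have "(C * pencil_inv A \<sigma> * B) $$ (0, 0) - (Ch * pencil_inv Ah \<sigma> * Bh) $$ (0, 0) = \<sigma> ^ k * h \<sigma>"
      using that err True by (auto simp del: index_mult_mat(1))
    then show ?thesis
      unfolding markov_expansion[OF A B C d(1), of k] markov_expansion[OF Ah Bh Ch d(2), of k]
      by (simp add: P_def poly_sum poly_monom g_def M_def algebra_simps sum_subtractf del: index_mult_mat(1))
  qed
  have ev: "\<forall>\<^sub>F \<sigma> in at 0. poly P \<sigma> = \<sigma> ^ k * g \<sigma>"
    using S True fac eventually_at_topological by blast
  have "M j = 0" if "j < k" for j
    using poly_coeff_zero_of_factor[OF g ev that] that
    by (simp add: P_def coeff_sum if_distrib cong: if_cong)
  then have "Ch * Ah ^\<^sub>m j * Bh = C * A ^\<^sub>m j * B" if "j < k" for j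
    using that B C Bh Ch by (intro eq_matI) (auto simp: M_def simp del: index_mult_mat(1))
  then show ?thesis using True by (auto simp: interpolates_def)
qed

lemma interpolates_mono: "interpolates Ah Bh Ch A B C \<mu> k \<Longrightarrow> k' \<le> k \<Longrightarrow> interpolates Ah Bh Ch A B C \<mu> k'"
  by (auto simp: interpolates_def)

section \<open>The stages as solution of one matrix equation\<close>

lemma sum_blocks:
  fixes f :: "nat \<Rightarrow> 'a::comm_monoid_add"
  shows "(\<Sum>p<N * s. f p) = (\<Sum>l<N. \<Sum>a<s. f (l * s + a))"
proof (induction N)
  case (Suc N)
  have split: "(\<Sum>p<k + t. f p) = (\<Sum>p<k. f p) + (\<Sum>a<t. f (k + a))" for k t
    by (induction t) (auto simp: add.assoc)
  show ?case using Suc split[of "N * s" s] by (simp add: add.commute)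
qed simp

lemma block_index_less:
  fixes l a s N :: nat
  assumes "l < N" "a < s"
  shows "l * s + a < N * s"
proof -
  have "l * s + a < Suc l * s" using assms by simp
  also have "\<dots> \<le> N * s" using assms by (intro mult_le_mono1) simp
  finally show ?thesis .
qed

lemma hat_Lambda_transpose_carrier: "hat_Lambda_transpose N s \<Lambda> \<beta> \<omega> \<in> carrier_mat (N * s) (N * s)"
  by (simp add: hat_Lambda_transpose_def)

text \<open>
  Block column \<open>j\<close> of \<open>A H L\<close> collects \<open>\<omega>\<^sub>l A H\<^sub>l \<beta> 1\<^sup>T\<close> for the earlier blocks \<open>l < j\<close>, which by the
  recursion for \<open>h\<close> is what \<open>h\<^sub>j - B\<close> contributes, and the implicit term of stage \<open>j\<close> from the
  diagonal block.
\<close>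

lemma approx_cholesky_stein:
  assumes A: "A \<in> carrier_mat n n" and B: "B \<in> carrier_mat n 1"
    and \<Lambda>: "\<Lambda> \<in> carrier_mat s s" and \<beta>: "\<beta> \<in> carrier_vec s"
    and ch: "approx_cholesky n N s A B \<Lambda> \<beta> \<beta>t \<omega> Z"
  shows "\<exists>H \<in> carrier_mat n (N * s).
     H = B * ones_row (N * s) + A * H * hat_Lambda_transpose N s \<Lambda> \<beta> \<omega> \<and>
     Z = Matrix.mat n (N * s) (\<lambda>(i, q). H $$ (i, q) *
            of_real (sqrt (\<omega> (q div s) * vec_index \<beta>t (q mod s))))"
proof -
  from ch obtain h K where h0: "h 0 = col B 0"
    and K: "\<And>j. j < N \<Longrightarrow> K j \<in> carrier_mat n s"
    and Keq: "\<And>j. j < N \<Longrightarrow> K j = Matrix.mat n s (\<lambda>(i, k). vec_index (h j) i)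
                 + of_real (\<omega> j) \<cdot>\<^sub>m (A * K j * transpose_mat \<Lambda>)"
    and hS: "\<And>j. j < N \<Longrightarrow> h (Suc j) = h j + of_real (\<omega> j) \<cdot>\<^sub>v (A *\<^sub>v (K j *\<^sub>v \<beta>))"
    and Z: "Z = Matrix.mat n (N * s) (\<lambda>(i, q). K (q div s) $$ (i, q mod s) *
              of_real (sqrt (\<omega> (q div s) * vec_index \<beta>t (q mod s))))"
    unfolding approx_cholesky_def by blast
  define H where "H = Matrix.mat n (N * s) (\<lambda>(i, q). K (q div s) $$ (i, q mod s))"
  have H: "H \<in> carrier_mat n (N * s)" by (simp add: H_def)
  have hj: "j \<le> N \<Longrightarrow> h j \<in> carrier_vec n \<and>
      (\<forall>i<n. vec_index (h j) i = B $$ (i, 0) + (\<Sum>l<j. \<Sum>a<s. (A * K l) $$ (i, a) * (of_real (\<omega> l) * vec_index \<beta> a)))" for j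
  proof (induction j)
    case 0
    then show ?case using B by (auto simp: h0)
  next
    case (Suc j)
    have Kj: "K j \<in> carrier_mat n s" using K Suc.prems by simp
    have entry: "vec_index (M *\<^sub>v \<beta>) i = (\<Sum>a<s. M $$ (i, a) * vec_index \<beta> a)"
      if "M \<in> carrier_mat n s" "i < n" for M i
      using that \<beta> by (simp add: scalar_prod_def lessThan_atLeast0)
    have "vec_index (A *\<^sub>v (K j *\<^sub>v \<beta>)) i = (\<Sum>a<s. (A * K j) $$ (i, a) * vec_index \<beta> a)" if "i < n" for i
      unfolding assoc_mult_mat_vec[OF A Kj \<beta>, symmetric] by (rule entry[OF mult_carrier_mat[OF A Kj] that])
    then show ?case using Suc A Kj \<beta>
      by (auto simp: hS sum_distrib_left mult_ac simp del: index_mult_mat(1) index_mult_mat_vec)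
  qed
  have eq: "H = B * ones_row (N * s) + A * H * hat_Lambda_transpose N s \<Lambda> \<beta> \<omega>"
  proof (rule eq_matI)
    let ?L = "hat_Lambda_transpose N s \<Lambda> \<beta> \<omega>"
    fix i q assume "i < dim_row (B * ones_row (N * s) + A * H * ?L)" "q < dim_col (B * ones_row (N * s) + A * H * ?L)"
    then have i: "i < n" and q: "q < N * s" using A B by (auto simp: hat_Lambda_transpose_def)
    define j b where "j = q div s" and "b = q mod s"
    have s0: "s > 0" using q by (cases s) auto
    have j: "j < N" and b: "b < s" using q s0 by (auto simp: j_def b_def less_mult_imp_div_less)
    have AH: "(A * H) $$ (i, l * s + a) = (A * K l) $$ (i, a)" if "l < N" "a < s" for l a
    proof -
      have "l * s + a < N * s"
        using that by (rule block_index_less)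
      then show ?thesis using A K[OF that(1)] i that by (simp add: H_def scalar_prod_def)
    qed
    have Lq: "?L $$ (l * s + a, q) = (if l = j then of_real (\<omega> j) * transpose_mat \<Lambda> $$ (a, b)
       else if l < j then of_real (\<omega> l) * vec_index \<beta> a else 0)" if "l < N" "a < s" for l a
    proof -
      have "l * s + a < N * s"
        using that by (rule block_index_less)
      then show ?thesis using q that by (simp add: hat_Lambda_transpose_def j_def b_def)
    qed
    have "(A * H * ?L) $$ (i, q) = (\<Sum>p<N * s. (A * H) $$ (i, p) * ?L $$ (p, q))"
      by (rule mult_mat_entry[OF mult_carrier_mat[OF A H] hat_Lambda_transpose_carrier i q])
    also have "\<dots> = (\<Sum>l<N. \<Sum>a<s. (A * K l) $$ (i, a) * (if l = j then of_real (\<omega> j) * transpose_mat \<Lambda> $$ (a, b)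
       else if l < j then of_real (\<omega> l) * vec_index \<beta> a else 0))"
      unfolding sum_blocks by (intro sum.cong refl) (simp add: AH Lq del: index_mult_mat(1))
    also have "\<dots> = (\<Sum>l<Suc j. \<Sum>a<s. (A * K l) $$ (i, a) * (if l = j then of_real (\<omega> j) * transpose_mat \<Lambda> $$ (a, b)
       else if l < j then of_real (\<omega> l) * vec_index \<beta> a else 0))"
      by (rule sum.mono_neutral_right) (use j in auto)
    also have "\<dots> = (\<Sum>l<j. \<Sum>a<s. (A * K l) $$ (i, a) * (of_real (\<omega> l) * vec_index \<beta> a))
        + of_real (\<omega> j) * (\<Sum>a<s. (A * K j) $$ (i, a) * transpose_mat \<Lambda> $$ (a, b))"
      by (simp add: sum_distrib_left mult_ac del: index_mult_mat(1) index_transpose_mat(1))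
    also have "(\<Sum>a<s. (A * K j) $$ (i, a) * transpose_mat \<Lambda> $$ (a, b)) = (A * K j * transpose_mat \<Lambda>) $$ (i, b)"
      using \<Lambda> by (intro mult_mat_entry[OF mult_carrier_mat[OF A K[OF j]] _ i b, symmetric]) simp
    finally have AHL: "B $$ (i, 0) + (A * H * ?L) $$ (i, q) = vec_index (h j) i + of_real (\<omega> j) * (A * K j * transpose_mat \<Lambda>) $$ (i, b)"
      using hj[of j] j i by (simp del: index_mult_mat(1))
    have "H $$ (i, q) = K j $$ (i, b)" using i q by (simp add: H_def j_def b_def)
    also have "\<dots> = (Matrix.mat n s (\<lambda>(i, k). vec_index (h j) i)
                 + of_real (\<omega> j) \<cdot>\<^sub>m (A * K j * transpose_mat \<Lambda>)) $$ (i, b)" using Keq[OF j] by simp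
    also have "\<dots> = vec_index (h j) i + of_real (\<omega> j) * (A * K j * transpose_mat \<Lambda>) $$ (i, b)"
      using A K[OF j] \<Lambda> i b by (simp del: index_mult_mat(1) assoc_mult_mat)
    also have "\<dots> = B $$ (i, 0) + (A * H * ?L) $$ (i, q)" using AHL by simp
    also have "B $$ (i, 0) = (B * ones_row (N * s)) $$ (i, q)"
      using B i q by (simp add: ones_row_def scalar_prod_def)
    also have "\<dots> + (A * H * ?L) $$ (i, q) = (B * ones_row (N * s) + A * H * ?L) $$ (i, q)"
      using A B H i q hat_Lambda_transpose_carrier[of N s \<Lambda> \<beta> \<omega>]
      by (simp add: ones_row_def del: index_mult_mat(1) assoc_mult_mat)
    finally show "H $$ (i, q) = (B * ones_row (N * s) + A * H * ?L) $$ (i, q)" .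
  qed (use A B in \<open>auto simp: H_def ones_row_def hat_Lambda_transpose_def\<close>)
  have "Z = Matrix.mat n (N * s) (\<lambda>(i, q). H $$ (i, q) *
            of_real (sqrt (\<omega> (q div s) * vec_index \<beta>t (q mod s))))"
    unfolding Z H_def by (rule cong_mat) auto
  with H eq show ?thesis by blast
qed

section \<open>The spectrum of the block triangular matrix\<close>

lemma char_poly_block_upper:
  fixes B :: "complex mat"
  assumes "B \<in> carrier_mat n n" "C \<in> carrier_mat n m" "D \<in> carrier_mat m m"
  shows "char_poly (four_block_mat B C (0\<^sub>m m n) D) = char_poly B * char_poly D"
proof (rule char_poly_0_block[OF refl _ _ assms])
  show "\<exists>es. char_poly B = (\<Prod>a\<leftarrow>es. [:- a, 1:])" using char_poly_factorized[OF assms(1)] by blast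
  show "\<exists>es. char_poly D = (\<Prod>a\<leftarrow>es. [:- a, 1:])" using char_poly_factorized[OF assms(3)] by blast
qed

text \<open>
  Appending a time step borders the matrix by one more block row and block column with a zero block
  below the diagonal.
\<close>

lemma char_poly_hat_Lambda:
  assumes \<Lambda>: "\<Lambda> \<in> carrier_mat s s"
  shows "char_poly (hat_Lambda_transpose N s \<Lambda> \<beta> \<omega>) = (\<Prod>i<N. char_poly (of_real (\<omega> i) \<cdot>\<^sub>m \<Lambda>))"
proof (induction N)
  case 0
  have "degree (char_poly (hat_Lambda_transpose 0 s \<Lambda> \<beta> \<omega>)) = 0 \<and> coeff (char_poly (hat_Lambda_transpose 0 s \<Lambda> \<beta> \<omega>)) 0 = 1"
    by (rule degree_monic_char_poly) (simp add: hat_Lambda_transpose_def)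
  then obtain c where "char_poly (hat_Lambda_transpose 0 s \<Lambda> \<beta> \<omega>) = [:c:]" "c = 1"
    by (metis coeff_pCons_0 degree_eq_zeroE)
  then show ?case by (simp add: one_pCons)
next
  case (Suc N)
  define C where "C = Matrix.mat (N * s) s (\<lambda>(p, _). of_real (\<omega> (p div s)) * vec_index \<beta> (p mod s))"
  have "hat_Lambda_transpose (Suc N) s \<Lambda> \<beta> \<omega>
     = four_block_mat (hat_Lambda_transpose N s \<Lambda> \<beta> \<omega>) C (0\<^sub>m s (N * s)) (of_real (\<omega> N) \<cdot>\<^sub>m transpose_mat \<Lambda>)" (is "?l = ?r")
  proof (rule eq_matI)
    fix p q assume "p < dim_row ?r" "q < dim_col ?r"
    then have pq: "p < N * s + s" "q < N * s + s" using \<Lambda> by (auto simp: hat_Lambda_transpose_def)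
    have div: "x div s < N" if "x < N * s" for x using that by (simp add: less_mult_imp_div_less)
    have last: "x div s = N \<and> x mod s = x - N * s" if "\<not> x < N * s" "x < N * s + s" for x
    proof -
      define y where "y = x - N * s"
      have "x = N * s + y" "y < s" using that by (auto simp: y_def)
      then show ?thesis by simp
    qed
    show "?l $$ (p, q) = ?r $$ (p, q)"
    proof -
      have dims: "dim_row (hat_Lambda_transpose N s \<Lambda> \<beta> \<omega>) = N * s" "dim_col (hat_Lambda_transpose N s \<Lambda> \<beta> \<omega>) = N * s"
        by (simp_all add: hat_Lambda_transpose_def)
      have r: "?r $$ (p, q) = (if p < N * s then if q < N * s then hat_Lambda_transpose N s \<Lambda> \<beta> \<omega> $$ (p, q)
          else C $$ (p, q - N * s) else if q < N * s then 0 else of_real (\<omega> N) * transpose_mat \<Lambda> $$ (p - N * s, q - N * s))"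
        using pq \<Lambda> by (subst index_mat_four_block(1)) (auto simp: dims)
      have l: "?l $$ (p, q) = (if p div s = q div s then of_real (\<omega> (p div s)) * transpose_mat \<Lambda> $$ (p mod s, q mod s)
          else if p div s < q div s then of_real (\<omega> (p div s)) * vec_index \<beta> (p mod s) else 0)"
        using pq by (simp add: hat_Lambda_transpose_def)
      show ?thesis
      proof (cases "p < N * s"; cases "q < N * s")
        assume "p < N * s" "q < N * s"
        then show ?thesis unfolding l r by (simp add: hat_Lambda_transpose_def)
      next
        assume c: "p < N * s" "\<not> q < N * s"
        then have "C $$ (p, q - N * s) = of_real (\<omega> (p div s)) * vec_index \<beta> (p mod s)"
          using pq by (simp add: C_def)
        then show ?thesis unfolding l r using c div[of p] last[of q] pq by simp
      next
        assume c: "\<not> p < N * s" "q < N * s"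
        then show ?thesis unfolding l r using div[of q] last[of p] pq by simp
      next
        assume c: "\<not> p < N * s" "\<not> q < N * s"
        then show ?thesis unfolding l r using last[of q] last[of p] pq by simp
      qed
    qed
  qed (use \<Lambda> in \<open>auto simp: hat_Lambda_transpose_def\<close>)
  moreover have "char_poly \<dots> = char_poly (hat_Lambda_transpose N s \<Lambda> \<beta> \<omega>) * char_poly (of_real (\<omega> N) \<cdot>\<^sub>m transpose_mat \<Lambda>)"
    by (rule char_poly_block_upper[OF hat_Lambda_transpose_carrier]) (use \<Lambda> in \<open>auto simp: C_def\<close>)
  moreover have "of_real (\<omega> N) \<cdot>\<^sub>m transpose_mat \<Lambda> = transpose_mat (of_real (\<omega> N) \<cdot>\<^sub>m \<Lambda>)"
    by (intro eq_matI) auto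
  moreover have "char_poly (transpose_mat (of_real (\<omega> N) \<cdot>\<^sub>m \<Lambda>)) = char_poly (of_real (\<omega> N) \<cdot>\<^sub>m \<Lambda>)"
    by (rule char_poly_transpose_mat[of _ s]) (use \<Lambda> in auto)
  ultimately show ?case using Suc by simp
qed

lemma spectrum_hat_Lambda:
  assumes \<Lambda>: "\<Lambda> \<in> carrier_mat s s"
  shows "spectrum (hat_Lambda N s \<Lambda> \<beta> \<omega>) = (\<Union>i<N. spectrum (of_real (\<omega> i) \<cdot>\<^sub>m \<Lambda>))"
proof -
  have "spectrum (hat_Lambda N s \<Lambda> \<beta> \<omega>) = {k. poly (char_poly (hat_Lambda N s \<Lambda> \<beta> \<omega>)) k = 0}"
    by (rule spectrum_root_char_poly[of _ "N * s"]) (simp add: hat_Lambda_def hat_Lambda_transpose_def)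
  also have "char_poly (hat_Lambda N s \<Lambda> \<beta> \<omega>) = (\<Prod>i<N. char_poly (of_real (\<omega> i) \<cdot>\<^sub>m \<Lambda>))"
    unfolding hat_Lambda_def char_poly_transpose_mat[OF hat_Lambda_transpose_carrier] char_poly_hat_Lambda[OF \<Lambda>] ..
  also have "{k. poly (\<Prod>i<N. char_poly (of_real (\<omega> i) \<cdot>\<^sub>m \<Lambda>)) k = 0}
      = (\<Union>i<N. {k. poly (char_poly (of_real (\<omega> i) \<cdot>\<^sub>m \<Lambda>)) k = 0})"
    by (auto simp: poly_prod)
  also have "\<dots> = (\<Union>i<N. spectrum (of_real (\<omega> i) \<cdot>\<^sub>m \<Lambda>))"
    using \<Lambda> by (subst spectrum_root_char_poly[of _ s]) auto
  finally show ?thesis .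
qed

lemma spectrum_smult:
  fixes M :: "complex mat"
  assumes M: "M \<in> carrier_mat s s" and c: "c \<noteq> 0" and "\<mu> \<in> spectrum (c \<cdot>\<^sub>m M)"
  shows "\<exists>\<mu>' \<in> spectrum M. \<mu> = c * \<mu>'"
proof -
  obtain v where v: "v \<in> carrier_vec s" "v \<noteq> 0\<^sub>v s" "(c \<cdot>\<^sub>m M) *\<^sub>v v = \<mu> \<cdot>\<^sub>v v"
    using assms(3) M by (auto simp: spectrum_def eigenvalue_def eigenvector_def)
  have cM: "(c \<cdot>\<^sub>m M) *\<^sub>v v = c \<cdot>\<^sub>v (M *\<^sub>v v)" using M v(1) by (intro eq_vecI) (auto simp: scalar_prod_def sum_distrib_left mult.assoc)
  have "M *\<^sub>v v = (1 / c) \<cdot>\<^sub>v (c \<cdot>\<^sub>v (M *\<^sub>v v))" using c by (simp add: smult_smult_assoc)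
  also have "\<dots> = (\<mu> / c) \<cdot>\<^sub>v v" unfolding cM[symmetric] v(3) by (simp add: smult_smult_assoc)
  finally have "\<mu> / c \<in> spectrum M"
    using v M by (auto simp: spectrum_def eigenvalue_def eigenvector_def)
  then show ?thesis using c by (intro bexI[of _ "\<mu> / c"]) auto
qed

text \<open>
  The solvability condition of the stage equations says precisely that the interpolation points avoid
  the poles of \<open>G\<close>.
\<close>

lemma inverse_hat_Lambda_eigenvalue:
  assumes \<Lambda>: "\<Lambda> \<in> carrier_mat s s" and pos: "\<forall>j<N. \<omega> j > 0"
    and nonres: "\<forall>j<N. \<forall>\<mu>\<in>spectrum \<Lambda>. \<forall>\<alpha>\<in>spectrum A. complex_of_real (\<omega> j) * \<mu> * \<alpha> \<noteq> 1"
    and \<mu>: "\<mu> \<in> spectrum (hat_Lambda N s \<Lambda> \<beta> \<omega>)" "\<mu> \<noteq> 0"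
  shows "inverse \<mu> \<notin> spectrum A"
proof
  assume a: "inverse \<mu> \<in> spectrum A"
  obtain j where j: "j < N" "\<mu> \<in> spectrum (of_real (\<omega> j) \<cdot>\<^sub>m \<Lambda>)"
    using \<mu>(1) unfolding spectrum_hat_Lambda[OF \<Lambda>] by auto
  obtain \<mu>' where "\<mu>' \<in> spectrum \<Lambda>" "\<mu> = of_real (\<omega> j) * \<mu>'"
    using spectrum_smult[OF \<Lambda> _ j(2)] pos j(1) by fastforce
  with nonres j(1) a have "\<mu> * inverse \<mu> \<noteq> 1" by blast
  then show False using \<mu>(2) by simp
qed


section \<open>Complex conjugation\<close>

abbreviation cnj_mat :: "complex mat \<Rightarrow> complex mat" where
  "cnj_mat \<equiv> map_mat cnj"

interpretation cnj_hom: inj_idom_divide_hom cnj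
  by unfold_locales auto

interpretation cnj_poly_hom: map_poly_inj_idom_divide_hom cnj ..

lemma observable_cnj:
  assumes L: "L \<in> carrier_mat m m" and e: "e \<in> carrier_mat 1 m" and obs: "observable L e"
  shows "observable (cnj_mat L) (cnj_mat e)"
proof -
  have "(cnj_mat e * cnj_mat L ^\<^sub>m k) $$ (0, j) = cnj ((e * L ^\<^sub>m k) $$ (0, j))" if "j < m" for k j
  proof -
    have "cnj_mat e * cnj_mat L ^\<^sub>m k = cnj_mat (e * L ^\<^sub>m k)"
      unfolding cnj_hom.mat_hom_pow[OF L, symmetric] by (rule cnj_hom.mat_hom_mult[symmetric, OF e pow_carrier_mat[OF L]])
    then show ?thesis using that e L pow_carrier_mat[OF L, of k] by (simp del: index_mult_mat(1))
  qed
  then have "Matrix.mat m m (\<lambda>(k, j). (cnj_mat e * cnj_mat L ^\<^sub>m k) $$ (0, j))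
      = cnj_mat (Matrix.mat m m (\<lambda>(k, j). (e * L ^\<^sub>m k) $$ (0, j)))"
    by (intro eq_matI) auto
  then show ?thesis using obs L by (simp add: observable_iff_det[of _ m] cnj_hom.hom_det)
qed

lemma order_char_poly_cnj:
  assumes "L \<in> carrier_mat m m"
  shows "Polynomial.order \<mu> (char_poly (cnj_mat L)) = Polynomial.order (cnj \<mu>) (char_poly L)"
  using cnj_poly_hom.order_hom[of "cnj \<mu>" "char_poly L"] cnj_hom.char_poly_hom[OF assms] by simp

text \<open>
  A real matrix has a spectrum symmetric about the real axis; this transfers the exclusion of
  \<open>1/\<nu>\<close> to the conjugate point, at which the second family of conditions interpolates.
\<close>

lemma spectrum_cmat_cnj:
  assumes A: "A \<in> carrier_mat n n" and "z \<in> spectrum (cmat A)"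
  shows "cnj z \<in> spectrum (cmat A)"
proof -
  have "cnj_mat (cmat A) = cmat A" by (intro eq_matI) auto
  then show ?thesis
    using cnj_hom.eigenvalue_hom[of "cmat A" n z] assms by (simp add: spectrum_def)
qed

lemma mat_adjoint_eq: "mat_adjoint M = transpose_mat (cnj_mat M)"
  by (intro eq_matI) (auto simp: mat_adjoint_def mat_of_rows_index)

lemma mat_adjoint_carrier: "(M :: complex mat) \<in> carrier_mat a b \<Longrightarrow> mat_adjoint M \<in> carrier_mat b a"
  by (simp add: mat_adjoint_eq)

lemma mat_adjoint_mult:
  fixes A B :: "complex mat"
  shows "A \<in> carrier_mat a b \<Longrightarrow> B \<in> carrier_mat b c \<Longrightarrow> mat_adjoint (A * B) = mat_adjoint B * mat_adjoint A"
  unfolding mat_adjoint_eq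
  by (subst cnj_hom.mat_hom_mult[of _ a b _ c]) (auto simp: transpose_mult[of _ a b _ c])

lemma mat_adjoint_adjoint: "mat_adjoint (mat_adjoint M) = (M :: complex mat)"
  unfolding mat_adjoint_eq by (intro eq_matI) auto

lemma mat_adjoint_real_diag: "mat_adjoint (mat_diag r (\<lambda>i. complex_of_real (d i))) = mat_diag r (\<lambda>i. of_real (d i))"
  unfolding mat_adjoint_eq by (intro eq_matI) (auto simp: mat_diag_def)

section \<open>Balancing as an oblique projection\<close>

text \<open>
  Full rank makes the factors \<open>U\<close> and \<open>T\<close> of the singular value decomposition square, hence unitary.
  So \<open>Zo\<^sup>H Zc = U \<Sigma> T\<^sup>H\<close> is invertible, and \<open>V W\<^sup>H = Zc (Zo\<^sup>H Zc)\<^sup>-\<^sup>1 Zo\<^sup>H\<close> is the projection onto the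
  range of \<open>Zc\<close> along the orthogonal complement of that of \<open>Zo\<close>.
\<close>

lemma balancing_projection:
  assumes Zc: "Zc \<in> carrier_mat n m" and Zo: "Zo \<in> carrier_mat n m"
    and rank: "vec_space.rank m (mat_adjoint Zo * Zc) = m"
    and bal: "approx_balancing A B C Zc Zo Ah Bh Ch"
  shows "\<exists>V Wt. V \<in> carrier_mat n m \<and> Wt \<in> carrier_mat m n \<and> Wt * V = 1\<^sub>m m \<and>
     V * (Wt * Zc) = Zc \<and> mat_adjoint Wt * (mat_adjoint V * Zo) = Zo \<and>
     Ah = Wt * A * V \<and> Bh = Wt * B \<and> Ch = C * V"
proof -
  define M where "M = mat_adjoint Zo * Zc"
  have M: "M \<in> carrier_mat m m" using Zc mat_adjoint_carrier[OF Zo] by (simp add: M_def)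
  define D where "D \<sigma> = mat_diag m (\<lambda>i. complex_of_real (1 / sqrt (\<sigma> i)))" for \<sigma> :: "nat \<Rightarrow> real"
  from bal rank M obtain U T \<sigma> where U: "U \<in> carrier_mat m m" and T: "T \<in> carrier_mat m m"
    and UU: "mat_adjoint U * U = 1\<^sub>m m" and TT: "mat_adjoint T * T = 1\<^sub>m m"
    and pos: "\<forall>i<m. \<sigma> i > 0"
    and svd: "M = U * mat_diag m (\<lambda>i. of_real (\<sigma> i)) * mat_adjoint T"
    and red: "Ah = mat_adjoint (Zo * U * D \<sigma>) * A * (Zc * T * D \<sigma>)"
      "Bh = mat_adjoint (Zo * U * D \<sigma>) * B" "Ch = C * (Zc * T * D \<sigma>)"
    unfolding approx_balancing_def compact_svd_def Let_def M_def[symmetric] D_def by auto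
  define \<Sigma> where "\<Sigma> = mat_diag m (\<lambda>i. complex_of_real (\<sigma> i))"
  define E where "E = D \<sigma>"
  have E: "E \<in> carrier_mat m m" and S: "\<Sigma> \<in> carrier_mat m m" by (auto simp: E_def D_def \<Sigma>_def)
  have EH: "mat_adjoint E = E" unfolding E_def D_def by (rule mat_adjoint_real_diag)
  have SH: "mat_adjoint \<Sigma> = \<Sigma>" unfolding \<Sigma>_def by (rule mat_adjoint_real_diag)
  have sq: "complex_of_real (1 / sqrt (\<sigma> i)) * complex_of_real (1 / sqrt (\<sigma> i)) * complex_of_real (\<sigma> i) = 1" if "i < m" for i
    using pos that by (simp add: less_imp_le less_imp_neq[symmetric] flip: of_real_mult)
  have diag_one: "mat_diag m f = 1\<^sub>m m" if "\<And>i. i < m \<Longrightarrow> f i = 1" for f :: "nat \<Rightarrow> complex"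
    using that by (intro eq_matI) (auto simp: mat_diag_def)
  have EES: "E * (E * \<Sigma>) = 1\<^sub>m m" and ESE: "E * (\<Sigma> * E) = 1\<^sub>m m"
    unfolding E_def D_def \<Sigma>_def mat_diag_diag using sq by (auto intro!: diag_one simp: mult_ac)
  define UH where "UH = mat_adjoint U"
  define TH where "TH = mat_adjoint T"
  define OH where "OH = mat_adjoint Zo"
  define CH where "CH = mat_adjoint Zc"
  have UH: "UH \<in> carrier_mat m m" and TH: "TH \<in> carrier_mat m m"
    and OH: "OH \<in> carrier_mat m n" and CH: "CH \<in> carrier_mat m n"
    using U T Zo Zc by (auto simp: UH_def TH_def OH_def CH_def intro: mat_adjoint_carrier)
  have UU': "UH * U = 1\<^sub>m m" "U * UH = 1\<^sub>m m" and TT': "TH * T = 1\<^sub>m m" "T * TH = 1\<^sub>m m"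
    using UU TT mat_mult_left_right_inverse[OF UH U] mat_mult_left_right_inverse[OF TH T]
    by (auto simp: UH_def TH_def)
  have M1: "OH * Zc = U * (\<Sigma> * TH)"
    using svd U S TH by (simp add: M_def OH_def \<Sigma>_def TH_def assoc_mult_mat[of _ m m _ m _ m])
  have M2: "CH * Zo = T * (\<Sigma> * UH)"
  proof -
    have "CH * Zo = mat_adjoint (OH * Zc)"
      using mat_adjoint_mult[OF OH Zc] by (simp add: CH_def OH_def mat_adjoint_adjoint)
    also have "\<dots> = mat_adjoint (U * (\<Sigma> * TH))" unfolding M1 ..
    also have "\<dots> = mat_adjoint (\<Sigma> * TH) * UH"
      unfolding UH_def by (rule mat_adjoint_mult[OF U]) (use S TH in auto)
    also have "mat_adjoint (\<Sigma> * TH) = T * \<Sigma>"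
      using mat_adjoint_mult[OF S TH] by (simp add: SH TH_def mat_adjoint_adjoint)
    finally show ?thesis using T S UH by (simp add: assoc_mult_mat[of _ m m _ m _ m])
  qed
  define V where "V = Zc * T * E"
  define Wt where "Wt = E * (UH * OH)"
  have V: "V \<in> carrier_mat n m" and Wt: "Wt \<in> carrier_mat m n"
    using Zc T E UH OH by (auto simp: V_def Wt_def)
  have Wt_eq: "mat_adjoint (Zo * U * D \<sigma>) = Wt"
    unfolding E_def[symmetric] Wt_def
    using mat_adjoint_mult[OF mult_carrier_mat[OF Zo U] E] mat_adjoint_mult[OF Zo U]
    by (simp add: EH UH_def OH_def)
  have VH: "mat_adjoint V = E * (TH * CH)"
    unfolding V_def using mat_adjoint_mult[OF mult_carrier_mat[OF Zc T] E] mat_adjoint_mult[OF Zc T]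
    by (simp add: EH TH_def CH_def)
  have WH: "mat_adjoint Wt = Zo * U * E"
    unfolding Wt_eq[symmetric] E_def mat_adjoint_adjoint ..
  have Ucancel: "UH * (U * X) = X" "T * (TH * X) = X" "U * (UH * X) = X" "TH * (T * X) = X"
      "E * (E * (\<Sigma> * X)) = X"
    if "X \<in> carrier_mat m k" for X k
  proof -
    show "UH * (U * X) = X" using assoc_mult_mat[OF UH U that] UU' that by simp
    show "T * (TH * X) = X" using assoc_mult_mat[OF T TH that] TT' that by simp
    show "U * (UH * X) = X" using assoc_mult_mat[OF U UH that] UU' that by simp
    show "TH * (T * X) = X" using assoc_mult_mat[OF TH T that] TT' that by simp
    have "E * (E * (\<Sigma> * X)) = (E * (E * \<Sigma>)) * X"
      using E S that by (simp add: assoc_mult_mat[of _ m m _ m _ k])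
    then show "E * (E * (\<Sigma> * X)) = X" using EES that by simp
  qed
  have WtZc: "Wt * Zc = E * (\<Sigma> * TH)"
  proof -
    have "Wt * Zc = E * (UH * (OH * Zc))"
      using E UH OH Zc by (simp add: Wt_def assoc_mult_mat[of _ m m _ n _ m])
    then show ?thesis unfolding M1 using Ucancel(1)[of "\<Sigma> * TH" m] S TH by simp
  qed
  have VHZo: "mat_adjoint V * Zo = E * (\<Sigma> * UH)"
  proof -
    have "mat_adjoint V * Zo = E * (TH * (CH * Zo))"
      using E TH CH Zo by (simp add: VH assoc_mult_mat[of _ m m _ n _ m])
    then show ?thesis unfolding M2 using Ucancel(4)[of "\<Sigma> * UH" m] S UH by simp
  qed
  have "Wt * V = (Wt * Zc) * (T * E)"
    using Wt Zc T E by (simp add: V_def assoc_mult_mat[of _ m n _ m _ m] assoc_mult_mat[of _ n m _ m _ m])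
  also have "\<dots> = E * (\<Sigma> * (TH * (T * E)))"
    unfolding WtZc using E S TH T by (simp add: assoc_mult_mat[of _ m m _ m _ m])
  also have "\<dots> = 1\<^sub>m m" using Ucancel(4)[OF E] ESE by simp
  finally have WV: "Wt * V = 1\<^sub>m m" .
  have "V * (Wt * Zc) = Zc * (T * (E * (E * (\<Sigma> * TH))))"
    unfolding WtZc V_def using Zc T E S TH
    by (simp add: assoc_mult_mat[of _ n m _ m _ m] assoc_mult_mat[of _ m m _ m _ m])
  also have "\<dots> = Zc" using Ucancel(5)[OF TH] TT' Zc by simp
  finally have VWZ: "V * (Wt * Zc) = Zc" .
  have "mat_adjoint Wt * (mat_adjoint V * Zo) = Zo * (U * (E * (E * (\<Sigma> * UH))))"
    unfolding VHZo WH using Zo U E S UH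
    by (simp add: assoc_mult_mat[of _ n m _ m _ m] assoc_mult_mat[of _ m m _ m _ m])
  also have "\<dots> = Zo" using Ucancel(5)[OF UH] UU' Zo by simp
  finally have WVZ: "mat_adjoint Wt * (mat_adjoint V * Zo) = Zo" .
  show ?thesis
    using V Wt WV VWZ WVZ red unfolding Wt_eq V_def[unfolded E_def, symmetric] by blast
qed

text \<open>
  Passes from the columns of a Cholesky factor to those of the unscaled stages.
\<close>

lemma fixed_by_column_scaling:
  fixes P Q H :: "complex mat"
  assumes P: "P \<in> carrier_mat n r" and Q: "Q \<in> carrier_mat r n" and H: "H \<in> carrier_mat n m"
    and d: "\<And>q. q < m \<Longrightarrow> d q \<noteq> 0"
    and fix_Z: "P * (Q * Matrix.mat n m (\<lambda>(i, q). H $$ (i, q) * d q)) = Matrix.mat n m (\<lambda>(i, q). H $$ (i, q) * d q)"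
  shows "P * (Q * H) = H"
proof -
  have Z: "Matrix.mat n m (\<lambda>(i, q). H $$ (i, q) * d q) = H * mat_diag m d"
    by (rule mat_diag_mult_right[OF H, symmetric])
  have dd: "mat_diag m d * mat_diag m (\<lambda>q. 1 / d q) = 1\<^sub>m m"
    unfolding mat_diag_diag using d by (intro eq_matI) (auto simp: mat_diag_def)
  have D: "mat_diag m f \<in> carrier_mat m m" for f :: "nat \<Rightarrow> complex" by simp
  have HD: "H * mat_diag m d * mat_diag m (\<lambda>q. 1 / d q) = H"
    using assoc_mult_mat[OF H D D] dd H by simp
  have "P * (Q * (H * mat_diag m d)) * mat_diag m (\<lambda>q. 1 / d q)
      = P * (Q * (H * mat_diag m d * mat_diag m (\<lambda>q. 1 / d q)))"
    using P Q H D by (simp add: assoc_mult_mat[of _ n r _ m _ m] assoc_mult_mat[of _ r n _ m _ m] del: mat_diag_diag)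
  then show ?thesis using fix_Z unfolding Z HD by (simp add: HD)
qed

section \<open>Interpolation by the reduced model\<close>

text \<open>
  The estimate from which every claim about interpolation follows. The observability side enters
  through the entrywise conjugate of \<open>Ho\<close>: balancing fixes \<open>Ho\<close> under \<open>Wt\<^sup>H V\<^sup>H\<close>, whereas the transposed
  system asks for \<open>Wt\<^sup>T V\<^sup>T\<close>. As \<open>A\<close> and \<open>C\<close> are real, conjugation only replaces \<open>Lo\<close> by its conjugate.
  At a point \<open>\<mu>\<close> outside one of the two spectra the corresponding order is \<open>0\<close>.
\<close>

lemma reduced_model_interpolates:
  fixes A B C :: "real mat"
  assumes A: "A \<in> carrier_mat n n" and B: "B \<in> carrier_mat n 1" and C: "C \<in> carrier_mat 1 n"
    and pos: "\<forall>j<N. \<omega> j > 0" "\<forall>j<N. \<tau> j > 0"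
    and \<beta>t: "\<forall>k<s. vec_index \<beta>tc k > 0" "\<forall>k<s. vec_index \<beta>to k > 0"
    and \<Lambda>: "\<Lambda>c \<in> carrier_mat s s" "\<Lambda>o \<in> carrier_mat s s"
    and \<beta>: "\<beta>c \<in> carrier_vec s" "\<beta>o \<in> carrier_vec s"
    and chc: "approx_cholesky n N s (cmat A) (cmat B) \<Lambda>c \<beta>c \<beta>tc \<omega> Zc"
    and cho: "approx_cholesky n N s (transpose_mat (cmat A)) (transpose_mat (cmat C)) \<Lambda>o \<beta>o \<beta>to \<tau> Zo"
    and bal: "approx_balancing (cmat A) (cmat B) (cmat C) Zc Zo Ah Bh Ch"
    and obsc: "observable (hat_Lambda_transpose N s \<Lambda>c \<beta>c \<omega>) (ones_row (N * s))"
    and obso: "observable (hat_Lambda_transpose N s \<Lambda>o \<beta>o \<tau>) (ones_row (N * s))"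
    and rank: "vec_space.rank (N * s) (mat_adjoint Zo * Zc) = N * s" and Ns: "N * s > 0"
    and regular: "\<mu> \<noteq> 0 \<Longrightarrow> inverse \<mu> \<notin> spectrum (cmat A)" "\<mu> \<noteq> 0 \<Longrightarrow> inverse \<mu> \<notin> spectrum Ah"
  shows "interpolates Ah Bh Ch (cmat A) (cmat B) (cmat C) \<mu>
      (Polynomial.order \<mu> (char_poly (hat_Lambda N s \<Lambda>c \<beta>c \<omega>))
       + Polynomial.order (cnj \<mu>) (char_poly (hat_Lambda N s \<Lambda>o \<beta>o \<tau>)))"
proof -
  define m where "m = N * s"
  define Lc where "Lc = hat_Lambda_transpose N s \<Lambda>c \<beta>c \<omega>"
  define Lo where "Lo = hat_Lambda_transpose N s \<Lambda>o \<beta>o \<tau>"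
  have Lc: "Lc \<in> carrier_mat m m" and Lo: "Lo \<in> carrier_mat m m"
    unfolding Lc_def Lo_def m_def by (rule hat_Lambda_transpose_carrier)+
  have cA: "cmat A \<in> carrier_mat n n" and cB: "cmat B \<in> carrier_mat n 1" and cC: "cmat C \<in> carrier_mat 1 n"
    using A B C by auto
  have ones: "ones_row m \<in> carrier_mat 1 m" "cnj_mat (ones_row m) = ones_row m"
    by (auto simp: ones_row_def intro!: eq_matI)
  have nonzero: "complex_of_real (sqrt (\<kappa> (q div s) * vec_index \<beta>t (q mod s))) \<noteq> 0"
    if "\<forall>j<N. \<kappa> j > 0" "\<forall>k<s. vec_index \<beta>t k > 0" "q < m" for \<kappa> q and \<beta>t :: "real Matrix.vec"
  proof -
    have "s > 0" using that(3) by (cases s) (auto simp: m_def)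
    then have "q div s < N" "q mod s < s" using that(3) by (auto simp: m_def less_mult_imp_div_less)
    then have "\<kappa> (q div s) > 0" "vec_index \<beta>t (q mod s) > 0" using that by auto
    then show ?thesis by simp
  qed
  obtain Hc where Hc: "Hc \<in> carrier_mat n m" and HcB: "Hc = cmat B * ones_row m + cmat A * Hc * Lc"
    and Zc: "Zc = Matrix.mat n m (\<lambda>(i, q). Hc $$ (i, q) * of_real (sqrt (\<omega> (q div s) * vec_index \<beta>tc (q mod s))))"
    using approx_cholesky_stein[OF cA cB \<Lambda>(1) \<beta>(1) chc] unfolding m_def[symmetric] Lc_def[symmetric]
    by (elim bexE exE conjE) (rule that; assumption)
  have tA: "transpose_mat (cmat A) \<in> carrier_mat n n" and tC: "transpose_mat (cmat C) \<in> carrier_mat n 1"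
    using cA cC by auto
  obtain Ho where Ho: "Ho \<in> carrier_mat n m"
    and HoC: "Ho = transpose_mat (cmat C) * ones_row m + transpose_mat (cmat A) * Ho * Lo"
    and Zo: "Zo = Matrix.mat n m (\<lambda>(i, q). Ho $$ (i, q) * of_real (sqrt (\<tau> (q div s) * vec_index \<beta>to (q mod s))))"
    using approx_cholesky_stein[OF tA tC \<Lambda>(2) \<beta>(2) cho] unfolding m_def[symmetric] Lo_def[symmetric]
    by (elim bexE exE conjE) (rule that; assumption)
  have Z: "Zc \<in> carrier_mat n m" "Zo \<in> carrier_mat n m" unfolding Zc Zo by auto
  obtain V Wt where V: "V \<in> carrier_mat n m" and Wt: "Wt \<in> carrier_mat m n" and WV: "Wt * V = 1\<^sub>m m"
    and VWZ: "V * (Wt * Zc) = Zc" and WVZ: "mat_adjoint Wt * (mat_adjoint V * Zo) = Zo"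
    and red: "Ah = Wt * cmat A * V" "Bh = Wt * cmat B" "Ch = cmat C * V"
    using balancing_projection[OF Z rank[folded m_def] bal] by (elim bexE exE conjE) (rule that; assumption)
  have VWH: "V * (Wt * Hc) = Hc"
    by (rule fixed_by_column_scaling[OF V Wt Hc nonzero[OF pos(1) \<beta>t(1)] VWZ[unfolded Zc]])
  have WVH: "mat_adjoint Wt * (mat_adjoint V * Ho) = Ho"
    by (rule fixed_by_column_scaling[OF mat_adjoint_carrier[OF Wt] mat_adjoint_carrier[OF V] Ho
          nonzero[OF pos(2) \<beta>t(2)] WVZ[unfolded Zo]])
  define H' where "H' = cnj_mat Ho"
  have H': "H' \<in> carrier_mat n m" using Ho by (simp add: H'_def)
  have cnj_adjoint: "cnj_mat (mat_adjoint M) = transpose_mat M" for M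
    unfolding mat_adjoint_eq by (intro eq_matI) auto
  have WVH': "transpose_mat Wt * (transpose_mat V * H') = H'"
  proof -
    have "cnj_mat (mat_adjoint Wt * (mat_adjoint V * Ho)) = transpose_mat Wt * (transpose_mat V * H')"
      unfolding cnj_hom.mat_hom_mult[OF mat_adjoint_carrier[OF Wt] mult_carrier_mat[OF mat_adjoint_carrier[OF V] Ho]]
        cnj_hom.mat_hom_mult[OF mat_adjoint_carrier[OF V] Ho] cnj_adjoint H'_def ..
    then show ?thesis unfolding WVH H'_def by (rule sym)
  qed
  have HC': "H' = transpose_mat (cmat C) * ones_row m + transpose_mat (cmat A) * H' * cnj_mat Lo"
  proof -
    have real: "cnj_mat (transpose_mat (cmat M)) = transpose_mat (cmat M)" for M
      by (intro eq_matI) auto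
    have add: "cnj_mat (X + Y) = cnj_mat X + cnj_mat Y"
      if "X \<in> carrier_mat n m" "Y \<in> carrier_mat n m" for X Y
      using that by (intro eq_matI) auto
    have "cnj_mat Ho = cnj_mat (transpose_mat (cmat C) * ones_row m) + cnj_mat (transpose_mat (cmat A) * Ho * Lo)"
      using arg_cong[OF HoC, of cnj_mat] add[OF mult_carrier_mat[OF tC ones(1)] mult_carrier_mat[OF mult_carrier_mat[OF tA Ho] Lo]]
      by (rule trans)
    also have "cnj_mat (transpose_mat (cmat C) * ones_row m) = transpose_mat (cmat C) * ones_row m"
      unfolding cnj_hom.mat_hom_mult[OF tC ones(1)] real ones(2) ..
    also have "cnj_mat (transpose_mat (cmat A) * Ho * Lo) = transpose_mat (cmat A) * H' * cnj_mat Lo"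
      unfolding cnj_hom.mat_hom_mult[OF mult_carrier_mat[OF tA Ho] Lo] cnj_hom.mat_hom_mult[OF tA Ho] real H'_def ..
    finally show ?thesis unfolding H'_def .
  qed
  have cLo: "cnj_mat Lo \<in> carrier_mat m m" using Lo by simp
  have obs': "observable (cnj_mat Lo) (ones_row m)"
    using observable_cnj[OF Lo ones(1)] obso unfolding Lo_def m_def[symmetric] ones(2) by simp
  have Ah: "Ah \<in> carrier_mat m m" "Bh \<in> carrier_mat m 1" "Ch \<in> carrier_mat 1 m"
    unfolding red using V Wt cA cB cC by auto
  have dets: "Determinant.det (pencil (cmat A) \<mu>) \<noteq> 0" "Determinant.det (pencil (Wt * cmat A * V) \<mu>) \<noteq> 0"
    using det_pencil_nonzero[OF cA] det_pencil_nonzero[OF Ah(1)] regular unfolding red(1) by auto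
  obtain S h where S: "open S" "\<mu> \<in> S" and h: "h holomorphic_on S" and
    err: "\<forall>\<sigma>\<in>S. Determinant.det (pencil (cmat A) \<sigma>) \<noteq> 0 \<and> Determinant.det (pencil Ah \<sigma>) \<noteq> 0 \<and>
       (cmat C * pencil_inv (cmat A) \<sigma> * cmat B) $$ (0, 0) - (Ch * pencil_inv Ah \<sigma> * Bh) $$ (0, 0)
         = (\<sigma> - \<mu>) ^ (Polynomial.order \<mu> (char_poly Lc) + Polynomial.order \<mu> (char_poly (cnj_mat Lo))) * h \<sigma>"
    using transfer_error_order[OF cA cB cC V Wt WV ones(1) Lc Hc HcB VWH
        obsc[folded Lc_def m_def] Ns[folded m_def] ones(1) cLo H' HC' WVH' obs' Ns[folded m_def] dets, folded red]
    by (elim bexE exE conjE) (rule that; assumption)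
  show ?thesis
    using interpolates_of_error_order[OF cA cB cC Ah S h err]
    unfolding order_char_poly_cnj[OF Lo]
    unfolding hat_Lambda_def char_poly_transpose_mat[OF hat_Lambda_transpose_carrier]
      Lc_def Lo_def .
qed

theorem theorem3p1:
  fixes n N s :: nat
    and A B C :: "real mat"
    and \<omega> \<tau> :: "nat \<Rightarrow> real"
    and \<beta>tc \<beta>to :: "real Matrix.vec"
    and \<Lambda>c \<Lambda>o :: "complex mat"
    and \<beta>c \<beta>o :: "complex Matrix.vec"
    and Zc Zo Ah Bh Ch :: "complex mat"
  assumes "A \<in> carrier_mat n n" "B \<in> carrier_mat n 1" "C \<in> carrier_mat 1 n"
    and "stable_mat A"
    and "minimal_system A B C"
    and "\<forall>j < N. \<omega> j > 0" "\<forall>j < N. \<tau> j > 0"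
    and "\<beta>tc \<in> carrier_vec s" "\<forall>k < s. vec_index \<beta>tc k > 0"
    and "\<beta>to \<in> carrier_vec s" "\<forall>k < s. vec_index \<beta>to k > 0"
    and "\<Lambda>c \<in> carrier_mat s s" "\<Lambda>o \<in> carrier_mat s s"
    and "\<beta>c \<in> carrier_vec s" "\<beta>o \<in> carrier_vec s"
    and "\<forall>j < N. \<forall>\<mu> \<in> spectrum \<Lambda>c. \<forall>\<alpha> \<in> spectrum (cmat A). of_real (\<omega> j) * \<mu> * \<alpha> \<noteq> 1"
    and "\<forall>j < N. \<forall>\<nu> \<in> spectrum \<Lambda>o. \<forall>\<alpha> \<in> spectrum (cmat A). of_real (\<tau> j) * \<nu> * \<alpha> \<noteq> 1"
    and "approx_cholesky n N s (cmat A) (cmat B) \<Lambda>c \<beta>c \<beta>tc \<omega> Zc"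
    and "approx_cholesky n N s (transpose_mat (cmat A)) (transpose_mat (cmat C)) \<Lambda>o \<beta>o \<beta>to \<tau> Zo"
    and "approx_balancing (cmat A) (cmat B) (cmat C) Zc Zo Ah Bh Ch"
    and "observable (transpose_mat (hat_Lambda N s \<Lambda>c \<beta>c \<omega>)) (ones_row (N * s))"
    and "observable (transpose_mat (hat_Lambda N s \<Lambda>o \<beta>o \<tau>)) (ones_row (N * s))"
    and "vec_space.rank (N * s) (mat_adjoint Zo * Zc) = N * s"
  shows "spectrum (hat_Lambda N s \<Lambda>c \<beta>c \<omega>) = (\<Union>i<N. spectrum (of_real (\<omega> i) \<cdot>\<^sub>m \<Lambda>c))
    \<and> spectrum (hat_Lambda N s \<Lambda>o \<beta>o \<tau>) = (\<Union>i<N. spectrum (of_real (\<tau> i) \<cdot>\<^sub>m \<Lambda>o))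
    \<and> (\<forall>\<mu> \<in> spectrum (hat_Lambda N s \<Lambda>c \<beta>c \<omega>).
         (\<mu> \<noteq> 0 \<longrightarrow> inverse \<mu> \<notin> spectrum Ah) \<longrightarrow>
         interpolates Ah Bh Ch (cmat A) (cmat B) (cmat C) \<mu>
           (Polynomial.order \<mu> (char_poly (hat_Lambda N s \<Lambda>c \<beta>c \<omega>))))
    \<and> (\<forall>\<nu> \<in> spectrum (hat_Lambda N s \<Lambda>o \<beta>o \<tau>).
         (\<nu> \<noteq> 0 \<longrightarrow> inverse (cnj \<nu>) \<notin> spectrum Ah) \<longrightarrow>
         interpolates Ah Bh Ch (cmat A) (cmat B) (cmat C) (cnj \<nu>)
           (Polynomial.order \<nu> (char_poly (hat_Lambda N s \<Lambda>o \<beta>o \<tau>))))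
    \<and> (\<forall>\<mu> \<in> spectrum (hat_Lambda N s \<Lambda>c \<beta>c \<omega>). \<forall>\<nu> \<in> spectrum (hat_Lambda N s \<Lambda>o \<beta>o \<tau>).
         \<mu> = cnj \<nu> \<longrightarrow> (\<mu> \<noteq> 0 \<longrightarrow> inverse \<mu> \<notin> spectrum Ah) \<longrightarrow>
         interpolates Ah Bh Ch (cmat A) (cmat B) (cmat C) \<mu>
           (Polynomial.order \<mu> (char_poly (hat_Lambda N s \<Lambda>c \<beta>c \<omega>))
            + Polynomial.order \<nu> (char_poly (hat_Lambda N s \<Lambda>o \<beta>o \<tau>))))"
proof -
  let ?Lc = "hat_Lambda N s \<Lambda>c \<beta>c \<omega>" and ?Lo = "hat_Lambda N s \<Lambda>o \<beta>o \<tau>"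
  note A = assms(1) and \<Lambda>c = assms(12) and \<Lambda>o = assms(13)
  have dims: "N * s > 0" if "\<mu> \<in> spectrum (hat_Lambda N s \<Lambda> \<beta> \<omega>)" for \<mu> \<Lambda> \<beta> \<omega>
    using eigenvalue_imp_nonzero_dim[of "hat_Lambda N s \<Lambda> \<beta> \<omega>" "N * s" \<mu>] that
    by (simp add: spectrum_def hat_Lambda_def hat_Lambda_transpose_def)
  have obs: "observable (hat_Lambda_transpose N s \<Lambda>c \<beta>c \<omega>) (ones_row (N * s))"
    "observable (hat_Lambda_transpose N s \<Lambda>o \<beta>o \<tau>) (ones_row (N * s))"
    using assms(21,22) by (simp_all add: hat_Lambda_def)
  have general: "interpolates Ah Bh Ch (cmat A) (cmat B) (cmat C) \<mu>
      (Polynomial.order \<mu> (char_poly ?Lc) + Polynomial.order (cnj \<mu>) (char_poly ?Lo))"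
    if "N * s > 0" "\<mu> \<noteq> 0 \<longrightarrow> inverse \<mu> \<notin> spectrum (cmat A)" "\<mu> \<noteq> 0 \<longrightarrow> inverse \<mu> \<notin> spectrum Ah" for \<mu>
    by (rule reduced_model_interpolates[OF assms(1-3,6,7,9,11-15,18-20) obs assms(23) that(1)])
      (use that in auto)
  have regc: "\<mu> \<noteq> 0 \<longrightarrow> inverse \<mu> \<notin> spectrum (cmat A)" if "\<mu> \<in> spectrum ?Lc" for \<mu>
    using inverse_hat_Lambda_eigenvalue[OF \<Lambda>c assms(6,16) that] by blast
  have rego: "cnj \<nu> \<noteq> 0 \<longrightarrow> inverse (cnj \<nu>) \<notin> spectrum (cmat A)" if "\<nu> \<in> spectrum ?Lo" for \<nu>
    using inverse_hat_Lambda_eigenvalue[OF \<Lambda>o assms(7,17) that] spectrum_cmat_cnj[OF A, of "inverse (cnj \<nu>)"]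
    by auto
  have c: "interpolates Ah Bh Ch (cmat A) (cmat B) (cmat C) \<mu> (Polynomial.order \<mu> (char_poly ?Lc))"
    if "\<mu> \<in> spectrum ?Lc" "\<mu> \<noteq> 0 \<longrightarrow> inverse \<mu> \<notin> spectrum Ah" for \<mu>
    using interpolates_mono[OF general[OF dims[OF that(1)] regc[OF that(1)] that(2)]] by simp
  have o: "interpolates Ah Bh Ch (cmat A) (cmat B) (cmat C) (cnj \<nu>) (Polynomial.order \<nu> (char_poly ?Lo))"
    if "\<nu> \<in> spectrum ?Lo" "\<nu> \<noteq> 0 \<longrightarrow> inverse (cnj \<nu>) \<notin> spectrum Ah" for \<nu>
    using interpolates_mono[OF general[OF dims[OF that(1)] rego[OF that(1)]]] that(2) by simp
  have both: "interpolates Ah Bh Ch (cmat A) (cmat B) (cmat C) \<mu>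
      (Polynomial.order \<mu> (char_poly ?Lc) + Polynomial.order \<nu> (char_poly ?Lo))"
    if "\<mu> \<in> spectrum ?Lc" "\<mu> = cnj \<nu>" "\<mu> \<noteq> 0 \<longrightarrow> inverse \<mu> \<notin> spectrum Ah" for \<mu> \<nu>
    using general[OF dims[OF that(1)] regc[OF that(1)] that(3)] that(2) by simp
  show ?thesis
  proof (intro conjI ballI impI)
    show "spectrum ?Lc = (\<Union>i<N. spectrum (of_real (\<omega> i) \<cdot>\<^sub>m \<Lambda>c))" by (rule spectrum_hat_Lambda[OF \<Lambda>c])
    show "spectrum ?Lo = (\<Union>i<N. spectrum (of_real (\<tau> i) \<cdot>\<^sub>m \<Lambda>o))" by (rule spectrum_hat_Lambda[OF \<Lambda>o])
  qed (use c o both in simp_all)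
qed

end
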